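(* Let $G$ be a connected non-compact Lie group. Consider a left-invariant and a right-invariant Riemannian metric on $G$ that coincide on the Lie algebra of $G$ (the tangent space at the identity). Let $d$ be the distance function on $G$ induced by the left-invariant metric and let $\rho$ be the measure on $G$ induced by the right-invariant metric (so $\rho$ is a right Haar measure). Let $w$ be an arbitrary radius-weight, let $1\le p<\infty$, and let $f\in\mathcal{L}_p(G)=\mathcal{L}_p(G,\rho)$. Then for every $x\in G$ such that $f$ is essentially bounded on a neighborhood of $x$, the function $I_{p,w}f$ is continuous at $x$. In particular, $I_{p,w}f$ is continuous almost everywhere.
   Context: $\mathcal{B}_{x,r}$ denotes the open $d$-ball with center $x$ and radius $r>0$. For a locally integrable function $f$ on $G$, $Af(x,r):=\frac{1}{\rho(\mathcal{B}_{x,r})}\int_{\mathcal{B}_{x,r}}|f|\,d\rho$ for $(x,r)\in G\times(0,\infty)$. A radius-weight is a nonnegative measurable function $w$ on $(0,\infty)$ with $\|w\|:=\int_0^\infty w(r)\,dr<\infty$ and $w\ne0$ almost everywhere. For $1\le p<\infty$, $I_{p,w}f:G\to[0,\infty]$ is defined by $I_{p,w}f(x):=\big(\int_0^\infty w(r)(Af(x,r))^p\,dr\big)^{1/p}$.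
   Formalization: The final claim, that I_{p,w}f is continuous almost everywhere, is proved only when f is essentially bounded on a neighborhood of almost every x; for arbitrary f in L_p it fails (e.g. on the real line, f with dense integrable poles and w large near 0). *)

theory Defs
  imports "HOL-Analysis.Analysis"
begin

section \<open>Smooth maps between open subsets of normed spaces\<close>

text \<open>
  For finite-dimensional \<open>'a\<close> and open \<open>S\<close> this is the usual class \<open>C\<^sup>k\<close>: all directional
  derivatives are of class \<open>C\<close> with exponent one less.
\<close>
primrec Ck_on :: "nat \<Rightarrow> 'a::real_normed_vector set \<Rightarrow> ('a \<Rightarrow> 'b::real_normed_vector) \<Rightarrow> bool" where
  "Ck_on 0 S f \<longleftrightarrow> continuous_on S f"
| "Ck_on (Suc k) S f \<longleftrightarrow>
     f differentiable_on S \<and> (\<forall>v. Ck_on k S (\<lambda>x. frechet_derivative f (at x) v))"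

definition smooth_map_on :: "'a::real_normed_vector set \<Rightarrow> ('a \<Rightarrow> 'b::real_normed_vector) \<Rightarrow> bool" where
  "smooth_map_on S f \<longleftrightarrow> (\<forall>k. Ck_on k S f)"

section \<open>Smooth atlases and Lie groups\<close>

text \<open>
  A chart is a pair of its domain and its coordinate map. The dimension \<open>CARD('n)\<close> is positive, which
  only excludes zero-dimensional groups; a connected zero-dimensional Lie group is trivial, hence compact.
\<close>
type_synonym ('g, 'n) chart = "'g set \<times> ('g \<Rightarrow> real ^ 'n)"

definition coord_inv :: "('g, 'n::finite) chart \<Rightarrow> real ^ 'n \<Rightarrow> 'g" where
  "coord_inv c = inv_into (fst c) (snd c)"

definition chart_image :: "('g, 'n::finite) chart \<Rightarrow> (real ^ 'n) set" where
  "chart_image c = snd c ` fst c"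

definition is_chart :: "('g::topological_space, 'n::finite) chart \<Rightarrow> bool" where
  "is_chart c \<longleftrightarrow> open (fst c) \<and> open (chart_image c) \<and>
     homeomorphism (fst c) (chart_image c) (snd c) (coord_inv c)"

definition smooth_atlas :: "('g::topological_space, 'n::finite) chart set \<Rightarrow> bool" where
  "smooth_atlas A \<longleftrightarrow>
     (\<forall>c\<in>A. is_chart c) \<and> (\<Union>c\<in>A. fst c) = UNIV \<and>
     (\<forall>c\<in>A. \<forall>c'\<in>A. smooth_map_on (snd c ` (fst c \<inter> fst c')) (snd c' \<circ> coord_inv c))"

text \<open>
  The group is written additively, but it is not assumed to be commutative: \<open>group_add\<close> is the library's
  class of arbitrary groups. Together with \<open>t2_space\<close> and \<open>second_countable_topology\<close>
  on the type, \<open>lie_group A\<close> says that the group is a Lie group with the smooth structure given by \<open>A\<close>.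
\<close>
definition lie_group ::
  "('g::{topological_group_add, t2_space, second_countable_topology}, 'n::finite) chart set \<Rightarrow> bool" where
  "lie_group A \<longleftrightarrow> smooth_atlas A \<and>
     (\<forall>c1\<in>A. \<forall>c2\<in>A. \<forall>c3\<in>A.
        smooth_map_on
          {(a, b). a \<in> chart_image c1 \<and> b \<in> chart_image c2 \<and> coord_inv c1 a + coord_inv c2 b \<in> fst c3}
          (\<lambda>(a, b). snd c3 (coord_inv c1 a + coord_inv c2 b))) \<and>
     (\<forall>c1\<in>A. \<forall>c2\<in>A.
        smooth_map_on
          {a. a \<in> chart_image c1 \<and> - coord_inv c1 a \<in> fst c2}
          (\<lambda>a. snd c2 (- coord_inv c1 a)))"

section \<open>Riemannian metrics\<close>

text \<open>
  A tangent vector at \<open>x\<close> is represented, in each chart \<open>c\<close> around \<open>x\<close>, by its coordinate vector;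
  \<open>g c x v w\<close> is the inner product of the tangent vectors at \<open>x\<close> with coordinates \<open>v\<close>, \<open>w\<close> in \<open>c\<close>.
  Values of \<open>g c x\<close> for \<open>c \<notin> A\<close> or \<open>x \<notin> fst c\<close> are irrelevant.
\<close>
type_synonym ('g, 'n) metric_tensor = "('g, 'n) chart \<Rightarrow> 'g \<Rightarrow> real ^ 'n \<Rightarrow> real ^ 'n \<Rightarrow> real"

text \<open>The differential of \<open>F\<close> at \<open>x\<close>, from coordinates in \<open>c\<close> to coordinates in \<open>c'\<close>.\<close>
definition chart_differential ::
  "('g, 'n::finite) chart \<Rightarrow> ('g, 'n) chart \<Rightarrow> ('g \<Rightarrow> 'g) \<Rightarrow> 'g \<Rightarrow> real ^ 'n \<Rightarrow> real ^ 'n" where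
  "chart_differential c c' F x = frechet_derivative (snd c' \<circ> F \<circ> coord_inv c) (at (snd c x))"

text \<open>
  The differential of \<open>F\<close> preserves \<open>g\<close>. For \<open>F = id\<close> this says that the coordinate expressions of \<open>g\<close>
  in different charts are related by the transformation law of a covariant 2-tensor.
\<close>
definition preserves_metric ::
  "('g, 'n::finite) chart set \<Rightarrow> ('g, 'n) metric_tensor \<Rightarrow> ('g \<Rightarrow> 'g) \<Rightarrow> bool" where
  "preserves_metric A g F \<longleftrightarrow>
     (\<forall>c\<in>A. \<forall>c'\<in>A. \<forall>x. x \<in> fst c \<and> F x \<in> fst c' \<longrightarrow>
        (\<forall>v w. g c x v w =
           g c' (F x) (chart_differential c c' F x v) (chart_differential c c' F x w)))"

definition riemannian_metric ::
  "('g, 'n::finite) chart set \<Rightarrow> ('g, 'n) metric_tensor \<Rightarrow> bool" where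
  "riemannian_metric A g \<longleftrightarrow>
     (\<forall>c\<in>A. \<forall>x\<in>fst c.
        bilinear (g c x) \<and> (\<forall>v w. g c x v w = g c x w v) \<and> (\<forall>v. v \<noteq> 0 \<longrightarrow> 0 < g c x v v)) \<and>
     (\<forall>c\<in>A. \<forall>v w. smooth_map_on (chart_image c) (\<lambda>a. g c (coord_inv c a) v w)) \<and>
     preserves_metric A g id"

definition left_invariant ::
  "('g::group_add, 'n::finite) chart set \<Rightarrow> ('g, 'n) metric_tensor \<Rightarrow> bool" where
  "left_invariant A g \<longleftrightarrow> (\<forall>a. preserves_metric A g (\<lambda>x. a + x))"

definition right_invariant ::
  "('g::group_add, 'n::finite) chart set \<Rightarrow> ('g, 'n) metric_tensor \<Rightarrow> bool" where
  "right_invariant A g \<longleftrightarrow> (\<forall>a. preserves_metric A g (\<lambda>x. x + a))"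

definition coincide_on_lie_algebra ::
  "('g::group_add, 'n::finite) chart set \<Rightarrow> ('g, 'n) metric_tensor \<Rightarrow> ('g, 'n) metric_tensor \<Rightarrow> bool" where
  "coincide_on_lie_algebra A g h \<longleftrightarrow> (\<forall>c\<in>A. 0 \<in> fst c \<longrightarrow> (\<forall>v w. g c 0 v w = h c 0 v w))"

section \<open>Riemannian distance\<close>

text \<open>One-sided derivatives are taken at the end points.\<close>
definition C1_curve_on ::
  "('g::topological_space, 'n::finite) chart set \<Rightarrow> real \<Rightarrow> real \<Rightarrow> (real \<Rightarrow> 'g) \<Rightarrow> bool" where
  "C1_curve_on A a b \<gamma> \<longleftrightarrow> continuous_on {a..b} \<gamma> \<and>
     (\<forall>c\<in>A. \<exists>D. continuous_on {t \<in> {a..b}. \<gamma> t \<in> fst c} D \<and>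
        (\<forall>t\<in>{a..b}. \<gamma> t \<in> fst c \<longrightarrow>
           ((snd c \<circ> \<gamma>) has_vector_derivative D t) (at t within {a..b})))"

definition piecewise_C1_curve ::
  "('g::topological_space, 'n::finite) chart set \<Rightarrow> (real \<Rightarrow> 'g) \<Rightarrow> bool" where
  "piecewise_C1_curve A \<gamma> \<longleftrightarrow>
     (\<exists>S. finite S \<and> {0, 1} \<subseteq> S \<and> S \<subseteq> {0..1} \<and>
        (\<forall>a\<in>S. \<forall>b\<in>S. a < b \<and> S \<inter> {a<..<b} = {} \<longrightarrow> C1_curve_on A a b \<gamma>))"

text \<open>
  By the transformation law the speed does not depend on the chart. At the finitely many break points of a
  piecewise \<open>C\<^sup>1\<close> curve its value is arbitrary, which does not affect the length.
\<close>
definition speed ::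
  "('g, 'n::finite) chart set \<Rightarrow> ('g, 'n) metric_tensor \<Rightarrow> (real \<Rightarrow> 'g) \<Rightarrow> real \<Rightarrow> real" where
  "speed A g \<gamma> t =
     (let c = (SOME c. c \<in> A \<and> \<gamma> t \<in> fst c);
          v = vector_derivative (snd c \<circ> \<gamma>) (at t)
      in sqrt (g c (\<gamma> t) v v))"

definition curve_length ::
  "('g, 'n::finite) chart set \<Rightarrow> ('g, 'n) metric_tensor \<Rightarrow> (real \<Rightarrow> 'g) \<Rightarrow> real" where
  "curve_length A g \<gamma> = integral {0..1} (speed A g \<gamma>)"

definition riemannian_dist ::
  "('g::topological_space, 'n::finite) chart set \<Rightarrow> ('g, 'n) metric_tensor \<Rightarrow> 'g \<Rightarrow> 'g \<Rightarrow> real" where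
  "riemannian_dist A g x y =
     Inf {curve_length A g \<gamma> | \<gamma>. piecewise_C1_curve A \<gamma> \<and> \<gamma> 0 = x \<and> \<gamma> 1 = y}"

section \<open>Riemannian measure\<close>

definition gram_matrix ::
  "('g, 'n::finite) metric_tensor \<Rightarrow> ('g, 'n) chart \<Rightarrow> 'g \<Rightarrow> real ^ 'n ^ 'n" where
  "gram_matrix g c x = (\<chi> i j. g c x (axis i 1) (axis j 1))"

text \<open>
  The Riemannian measure is the unique Borel measure with density \<open>sqrt (det g\<^sub>i\<^sub>j)\<close> in every chart.
\<close>
definition is_riemannian_measure ::
  "('g::topological_space, 'n::finite) chart set \<Rightarrow> ('g, 'n) metric_tensor \<Rightarrow> 'g measure \<Rightarrow> bool" where
  "is_riemannian_measure A g \<rho> \<longleftrightarrow> sets \<rho> = sets borel \<and>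
     (\<forall>c\<in>A. \<forall>E\<in>sets borel. E \<subseteq> fst c \<longrightarrow>
        emeasure \<rho> E =
          (\<integral>\<^sup>+a\<in>snd c ` E. ennreal (sqrt (det (gram_matrix g c (coord_inv c a)))) \<partial>lborel))"

section \<open>Averages over balls\<close>

definition dist_ball :: "('g \<Rightarrow> 'g \<Rightarrow> real) \<Rightarrow> 'g \<Rightarrow> real \<Rightarrow> 'g set" where
  "dist_ball d x r = {y. d x y < r}"

definition ball_average ::
  "('g \<Rightarrow> 'g \<Rightarrow> real) \<Rightarrow> 'g measure \<Rightarrow> ('g \<Rightarrow> 'k::real_normed_field) \<Rightarrow> 'g \<Rightarrow> real \<Rightarrow> ennreal" where
  "ball_average d \<rho> f x r =
     (\<integral>\<^sup>+y\<in>dist_ball d x r. ennreal (norm (f y)) \<partial>\<rho>) / emeasure \<rho> (dist_ball d x r)"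

text \<open>Real powers on \<open>[0, \<infinity>]\<close>, for positive exponents.\<close>
definition ennreal_powr :: "ennreal \<Rightarrow> real \<Rightarrow> ennreal" where
  "ennreal_powr a p = (if a = \<infinity> then \<infinity> else ennreal (enn2real a powr p))"

definition radius_weight :: "(real \<Rightarrow> real) \<Rightarrow> bool" where
  "radius_weight w \<longleftrightarrow>
     w \<in> borel_measurable (lebesgue_on {0<..}) \<and> (\<forall>r>0. 0 \<le> w r) \<and>
     (\<integral>\<^sup>+r. ennreal (w r) \<partial>lebesgue_on {0<..}) < \<infinity> \<and>
     (AE r in lebesgue_on {0<..}. w r \<noteq> 0)"

definition I_op ::
  "('g \<Rightarrow> 'g \<Rightarrow> real) \<Rightarrow> 'g measure \<Rightarrow> real \<Rightarrow> (real \<Rightarrow> real) \<Rightarrow> ('g \<Rightarrow> 'k::real_normed_field) \<Rightarrow> 'g \<Rightarrow> ennreal" where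
  "I_op d \<rho> p w f x =
     ennreal_powr
       (\<integral>\<^sup>+r. ennreal (w r) * ennreal_powr (ball_average d \<rho> f x r) p \<partial>lebesgue_on {0<..})
       (1 / p)"

text \<open>Elements of \<open>L\<^sub>p\<close> are represented by measurable functions.\<close>
definition in_Lp :: "'g measure \<Rightarrow> real \<Rightarrow> ('g \<Rightarrow> 'k::real_normed_field) \<Rightarrow> bool" where
  "in_Lp \<rho> p f \<longleftrightarrow> f \<in> borel_measurable \<rho> \<and> (\<integral>\<^sup>+y. ennreal (norm (f y) powr p) \<partial>\<rho>) < \<infinity>"

text \<open>
  A function in \<open>L\<^sub>p\<close> may fail this at every \<open>x\<close>: take dense countably many integrable poles. For a weight that is
  large near 0, the operator \<open>I\<^sub>p\<^sub>,\<^sub>w\<close> may then be infinite on a dense set but finite almost everywhere, hence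
  discontinuous almost everywhere. So continuity almost everywhere requires this property almost everywhere.
\<close>
definition ess_bounded_near ::
  "'g::topological_space measure \<Rightarrow> ('g \<Rightarrow> 'k::real_normed_field) \<Rightarrow> 'g \<Rightarrow> bool" where
  "ess_bounded_near \<rho> f x \<longleftrightarrow>
     (\<exists>U C. open U \<and> x \<in> U \<and> (AE y in \<rho>. y \<in> U \<longrightarrow> norm (f y) \<le> C))"

end

theory Submission
  imports Defs
begin

text \<open>
  Since \<open>B(x, r - d(y, x)) \<subseteq> B(y, r) \<subseteq> B(x, r + d(x, y))\<close>, the integrals of a fixed nonnegative function over
  \<open>B(y, r)\<close> converge as \<open>y \<rightarrow> x\<close> whenever \<open>r\<close> is a continuity point of the monotone function
  \<open>r \<mapsto> \<integral>\<^bsub>B(x,r)\<^esub>\<close>, that is, for all but countably many \<open>r\<close>. Hence the averages over \<open>B(y, r)\<close> converge for almost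
  every \<open>r\<close>. For \<open>y\<close> near \<open>x\<close> they are bounded, for small \<open>r\<close> by the essential bound of \<open>f\<close> near \<open>x\<close>
  and for the other \<open>r\<close> by Hoelder's inequality, because the measures of these balls are bounded below by that of a
  fixed ball around \<open>x\<close>. Dominated convergence then gives the continuity of \<open>I\<^sub>p\<^sub>,\<^sub>w f\<close> at \<open>x\<close>. The geometric
  input is that the Riemannian distance satisfies the triangle inequality and induces the topology, and that nonempty open
  sets have positive measure.
\<close>

section \<open>Averages over balls of a distance compatible with the topology\<close>

lemma inverse_antimono_ennreal: "a \<le> b \<Longrightarrow> inverse b \<le> inverse (a :: ennreal)"
  including ennreal.lifting by transfer (rule ereal_inverse_antimono)

text \<open>The increasing map v -> -1/(1 + v) carries [0, \<infinity>] onto [-1, 0], which makes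
  facts about real monotone functions available; inverting it recovers \<open>m\<close>.\<close>

lemma mono_ennreal_obtain_real:
  fixes m :: "real \<Rightarrow> ennreal"
  assumes "mono m"
  obtains k :: "real \<Rightarrow> real" where "mono k" "m = (\<lambda>r. inverse (ennreal (- k r)) - 1)"
proof
  let ?k = "\<lambda>r. - enn2real (inverse (1 + m r))"
  have fin: "inverse (1 + v) < top" for v :: ennreal
    by (simp add: less_top[symmetric] add_eq_0_iff_both_eq_0)
  show "mono ?k"
  proof (rule monoI)
    fix a b :: real assume "a \<le> b"
    then have "1 + m a \<le> 1 + m b"
      using assms by (auto dest: monoD intro: add_left_mono)
    then have "inverse (1 + m b) \<le> inverse (1 + m a)"
      by (rule inverse_antimono_ennreal)
    then show "?k a \<le> ?k b"
      using enn2real_mono fin by auto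
  qed
  show "m = (\<lambda>r. inverse (ennreal (- ?k r)) - 1)"
  proof
    fix r
    have "ennreal (- ?k r) = inverse (1 + m r)"
      using fin by simp
    then show "m r = inverse (ennreal (- ?k r)) - 1"
      using one_divide_one_divide_ennreal[of "1 + m r"] by (simp add: divide_ennreal_def)
  qed
qed

text \<open>A real monotone function has only countably many discontinuities. Undoing the
  transformation preserves continuity, because inversion is continuous on \<open>ennreal\<close> and
  the subtrahend 1 is finite.\<close>

lemma mono_ennreal_countable_discont:
  fixes m :: "real \<Rightarrow> ennreal"
  assumes "mono m"
  shows "countable {r. \<not> isCont m r}"
proof -
  obtain k :: "real \<Rightarrow> real" where k: "mono k" and m: "m = (\<lambda>r. inverse (ennreal (- k r)) - 1)"
    using mono_ennreal_obtain_real[OF assms] .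
  have "isCont m r" if "isCont k r" for r
  proof -
    have "isCont (\<lambda>r. ennreal (- k r)) r"
      using that unfolding isCont_def by (intro tendsto_ennrealI tendsto_minus)
    then have 1: "isCont (\<lambda>r. inverse (ennreal (- k r))) r"
      using isCont_o2[of r "\<lambda>r. ennreal (- k r)" inverse] continuous_on_inverse_ennreal[OF continuous_on_id, of UNIV]
      by (auto simp: continuous_on_eq_continuous_at)
    then show ?thesis
      unfolding m isCont_def by (intro tendsto_diff_ennreal_general) (auto simp: isCont_def)
  qed
  then have "{r. \<not> isCont m r} \<subseteq> {r. \<not> isCont k r}" by blast
  then show ?thesis
    using mono_ctble_discont[OF k] countable_subset by blast
qed

lemma borel_measurable_mono_ennreal:
  fixes m :: "real \<Rightarrow> ennreal"
  assumes "mono m"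
  shows "m \<in> borel_measurable borel"
proof -
  obtain k :: "real \<Rightarrow> real" where k: "mono k" and m: "m = (\<lambda>r. inverse (ennreal (- k r)) - 1)"
    using mono_ennreal_obtain_real[OF assms] .
  have [measurable]: "k \<in> borel_measurable borel"
    by (rule borel_measurable_mono[OF k])
  show ?thesis unfolding m by measurable
qed

section \<open>Powers on [0, \<infinity>] and an inequality of Hoelder type\<close>

lemma ennreal_powr_mono: "a \<le> b \<Longrightarrow> 0 \<le> p \<Longrightarrow> ennreal_powr a p \<le> ennreal_powr b p"
  by (auto simp: ennreal_powr_def top_unique less_top[symmetric]
      intro!: ennreal_leI powr_mono2 enn2real_mono)

lemma ennreal_powr_ennreal: "0 \<le> a \<Longrightarrow> ennreal_powr (ennreal a) p = ennreal (a powr p)"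
  by (simp add: ennreal_powr_def)

lemma measurable_ennreal_powr [measurable (raw)]:
  assumes [measurable]: "g \<in> borel_measurable M"
  shows "(\<lambda>x. ennreal_powr (g x) p) \<in> borel_measurable M"
  unfolding ennreal_powr_def by measurable

lemma tendsto_ennreal_powr:
  assumes "(g \<longlongrightarrow> a) F" "a \<noteq> \<infinity>" "0 < p"
  shows "((\<lambda>x. ennreal_powr (g x) p) \<longlongrightarrow> ennreal_powr a p) F"
proof -
  have "a < top" using assms(2) by (simp add: less_top)
  have 1: "eventually (\<lambda>x. g x < top) F"
    by (rule order_tendstoD(2)[OF assms(1) \<open>a < top\<close>])
  have "((\<lambda>x. enn2real (g x)) \<longlongrightarrow> enn2real a) F"
    by (rule tendsto_enn2real[OF _ _ ]) (use assms \<open>a < top\<close> in \<open>auto simp: less_top\<close>)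
  then have "((\<lambda>x. ennreal (enn2real (g x) powr p)) \<longlongrightarrow> ennreal (enn2real a powr p)) F"
    using assms(3) by (intro tendsto_ennrealI tendsto_powr') auto
  moreover have "eventually (\<lambda>x. ennreal (enn2real (g x) powr p) = ennreal_powr (g x) p) F"
    using 1 by eventually_elim (auto simp: ennreal_powr_def)
  ultimately show ?thesis
    using assms(2) by (auto simp: ennreal_powr_def intro: Lim_transform_eventually)
qed

text \<open>For t > s the nonpositive exponent 1 - p gives t powr (1 - p) \<le> s powr (1 - p).
  Integrated over a set, this bounds the integral of |f| by the measure of the set and the integral
  of the p-th power, with \<open>s\<close> free to be chosen.\<close>

lemma le_add_powr_mult_powr:
  fixes s t p :: real
  assumes "0 < s" "0 \<le> t" "1 \<le> p"
  shows "t \<le> s + s powr (1 - p) * t powr p"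
proof (cases "t \<le> s")
  case True
  then show ?thesis by (simp add: add_increasing2)
next
  case False
  have "t = t powr (1 - p) * t powr p"
    using False assms by (simp add: powr_add[symmetric])
  also have "\<dots> \<le> s powr (1 - p) * t powr p"
    using False assms by (intro mult_right_mono powr_mono2') auto
  finally show ?thesis using assms by linarith
qed

lemma in_Lp_obtain_bound:
  assumes "in_Lp M p f"
  obtains F where "0 < F" "(\<integral>\<^sup>+y. ennreal (norm (f y) powr p) \<partial>M) \<le> ennreal F"
proof (cases "\<integral>\<^sup>+y. ennreal (norm (f y) powr p) \<partial>M")
  case (real v)
  \<comment> \<open>Adding 1 keeps the bound positive even if the integral is 0; the scale
    \<open>s\<close> in \<open>average_powr_le\<close> has to be positive.\<close>
  then show ?thesis by (intro that[of "v + 1"]) (auto intro: ennreal_leI)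
qed (use assms in \<open>auto simp: in_Lp_def\<close>)

text \<open>Hoelder's inequality up to the harmless factor \<open>2 powr p\<close>.\<close>
lemma average_powr_le:
  fixes f :: "'a \<Rightarrow> 'k::real_normed_vector"
  assumes [measurable]: "f \<in> borel_measurable M" "B \<in> sets M"
    and fin: "(\<integral>\<^sup>+y. ennreal (norm (f y) powr p) \<partial>M) \<le> ennreal F" "0 < F"
    and pos: "emeasure M B \<noteq> 0" and p: "1 \<le> p"
  shows "ennreal_powr ((\<integral>\<^sup>+y\<in>B. ennreal (norm (f y)) \<partial>M) / emeasure M B) p \<le> ennreal (2 powr p * F) / emeasure M B"
proof (cases "emeasure M B = top")
  case True
  \<comment> \<open>Division by \<open>top\<close> yields 0 in \<open>ennreal\<close>, so the left
    side is 0.\<close>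
  then show ?thesis using p by (simp add: ennreal_powr_def)
next
  case False
  then obtain v where v: "emeasure M B = ennreal v" "0 \<le> v"
    by (cases "emeasure M B") auto
  then have "0 < v" using pos by (auto simp: less_le)
  \<comment> \<open>This scale balances the two terms: s powr (1 - p) * F = s * v, so their sum is 2
    * s * v.\<close>
  define s where "s = (F / v) powr (1 / p)"
  have s: "0 < s" using \<open>0 < v\<close> \<open>0 < F\<close> by (simp add: s_def)
  have sp: "s powr p = F / v"
    using \<open>0 < v\<close> \<open>0 < F\<close> p by (simp add: s_def powr_powr)
  have "(\<integral>\<^sup>+y\<in>B. ennreal (norm (f y)) \<partial>M)
      \<le> (\<integral>\<^sup>+y. ennreal s * indicator B y + ennreal (s powr (1 - p)) * ennreal (norm (f y) powr p) \<partial>M)"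
  proof (rule nn_integral_mono)
    fix y
    have "ennreal (norm (f y)) \<le> ennreal (s + s powr (1 - p) * norm (f y) powr p)"
      using le_add_powr_mult_powr[OF s _ p] by (intro ennreal_leI) auto
    also have "\<dots> = ennreal s + ennreal (s powr (1 - p)) * ennreal (norm (f y) powr p)"
      using s by (simp add: ennreal_mult)
    finally show "ennreal (norm (f y)) * indicator B y
      \<le> ennreal s * indicator B y + ennreal (s powr (1 - p)) * ennreal (norm (f y) powr p)"
      by (auto simp: indicator_def)
  qed
  also have "\<dots> = ennreal s * ennreal v + ennreal (s powr (1 - p)) * (\<integral>\<^sup>+y. ennreal (norm (f y) powr p) \<partial>M)"
    by (subst nn_integral_add) (auto simp: nn_integral_cmult v)
  also have "\<dots> \<le> ennreal s * ennreal v + ennreal (s powr (1 - p)) * ennreal F"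
    using fin by (intro add_left_mono mult_left_mono) auto
  also have "\<dots> = ennreal (s * v + s powr (1 - p) * F)"
    using s \<open>0 < v\<close> fin by (simp add: ennreal_mult)
  also have "s powr (1 - p) * F = s powr (1 - p) * s powr p * v"
    using \<open>0 < v\<close> by (simp add: sp)
  also have "s powr (1 - p) * s powr p = s"
    using s by (simp add: powr_add[symmetric])
  finally have "(\<integral>\<^sup>+y\<in>B. ennreal (norm (f y)) \<partial>M) \<le> ennreal (2 * s) * ennreal v"
    using s \<open>0 < v\<close> by (simp add: ennreal_mult[symmetric] mult.assoc)
  then have "(\<integral>\<^sup>+y\<in>B. ennreal (norm (f y)) \<partial>M) / ennreal v \<le> ennreal (2 * s)"
    using \<open>0 < v\<close> by (intro divide_le_posI_ennreal) (auto simp: mult.commute)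
  then have "ennreal_powr ((\<integral>\<^sup>+y\<in>B. ennreal (norm (f y)) \<partial>M) / ennreal v) p \<le> ennreal_powr (ennreal (2 * s)) p"
    using p by (intro ennreal_powr_mono) auto
  also have "\<dots> = ennreal (2 powr p * F) / ennreal v"
    using s p \<open>0 < v\<close> \<open>0 < F\<close> by (simp add: ennreal_powr_ennreal powr_mult sp divide_ennreal)
  finally show ?thesis unfolding v .
qed

section \<open>Continuity of the averages for an abstract distance and measure\<close>

locale compatible_distance =
  fixes d :: "'g::{t2_space, second_countable_topology} \<Rightarrow> 'g \<Rightarrow> real" and \<rho> :: "'g measure"
  assumes sets_eq_borel: "sets \<rho> = sets borel"
    and triangle: "d x z \<le> d x y + d y z"
    and tendsto_dist_right: "((\<lambda>y. d x y) \<longlongrightarrow> 0) (nhds x)"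
    and tendsto_dist_left: "((\<lambda>y. d y x) \<longlongrightarrow> 0) (nhds x)"
    and ball_subset_open: "open U \<Longrightarrow> x \<in> U \<Longrightarrow> \<exists>\<delta>>0. dist_ball d x \<delta> \<subseteq> U"
    and emeasure_open: "open U \<Longrightarrow> U \<noteq> {} \<Longrightarrow> emeasure \<rho> U \<noteq> 0"
begin

text \<open>A property that holds eventually in \<open>nhds x\<close>, unlike \<open>at x\<close>,
  holds at \<open>x\<close> itself; hence |d x x| is below every positive number.\<close>

lemma dist_self: "d x x = 0"
  using tendsto_dist_right[of x] unfolding tendsto_iff
  by (metis (no_types, lifting) dense_eq0_I dist_real_def diff_zero eventually_nhds_x_imp_x less_imp_le)

text \<open>The triangle inequality through \<open>y\<close>. As \<open>d\<close> is not assumed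
  symmetric, the order of the arguments in the radius matters. With the centres exchanged, the lemma
  also compares the balls in the other direction.\<close>

lemma ball_shift: "dist_ball d y (r - d x y) \<subseteq> dist_ball d x r"
  using le_less_trans[OF triangle[of x _ y]] by (auto simp: dist_ball_def)

lemma ball_mono: "r \<le> s \<Longrightarrow> dist_ball d x r \<subseteq> dist_ball d x s"
  by (auto simp: dist_ball_def)

lemma open_ball: "open (dist_ball d x r)"
proof (subst open_subopen, intro ballI)
  fix y assume "y \<in> dist_ball d x r"
  then have "0 < r - d x y" by (simp add: dist_ball_def)
  then have "eventually (\<lambda>z. d y z < r - d x y) (nhds y)"
    using order_tendstoD(2)[OF tendsto_dist_right] by blast
  then obtain T where "open T" "y \<in> T" "\<And>z. z \<in> T \<Longrightarrow> d y z < r - d x y"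
    unfolding eventually_nhds by blast
  then show "\<exists>T. open T \<and> y \<in> T \<and> T \<subseteq> dist_ball d x r"
    using ball_shift[of y r x] by (intro exI[of _ T]) (auto simp: dist_ball_def)
qed

lemma sets_ball [measurable]: "dist_ball d x r \<in> sets \<rho>"
  using open_ball by (simp add: sets_eq_borel)

lemma emeasure_ball: "0 < r \<Longrightarrow> emeasure \<rho> (dist_ball d x r) \<noteq> 0"
  using emeasure_open[OF open_ball, of x r] dist_self[of x] unfolding dist_ball_def by (metis empty_iff mem_Collect_eq)

lemma mono_integral_ball: "mono (\<lambda>r. \<integral>\<^sup>+y\<in>dist_ball d x r. h y \<partial>\<rho>)"
  by (intro monoI nn_set_integral_set_mono ball_mono)

text \<open>Lets the results on integrals over balls apply to the measures of balls, with h =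
  1.\<close>

lemma emeasure_ball_eq: "emeasure \<rho> (dist_ball d x r) = (\<integral>\<^sup>+y\<in>dist_ball d x r. 1 \<partial>\<rho>)"
  by simp

lemma tendsto_integral_ball:
  assumes cont: "isCont (\<lambda>r. \<integral>\<^sup>+y\<in>dist_ball d x r. h y \<partial>\<rho>) r" and Y: "(Y \<longlongrightarrow> x) F"
  shows "((\<lambda>n. \<integral>\<^sup>+y\<in>dist_ball d (Y n) r. h y \<partial>\<rho>) \<longlongrightarrow> (\<integral>\<^sup>+y\<in>dist_ball d x r. h y \<partial>\<rho>)) F"
proof (rule tendsto_sandwich)
  let ?m = "\<lambda>r. \<integral>\<^sup>+y\<in>dist_ball d x r. h y \<partial>\<rho>"
  have "((\<lambda>n. r - d (Y n) x) \<longlongrightarrow> r - 0) F"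
    by (intro tendsto_intros filterlim_compose[OF tendsto_dist_left Y])
  then show "((\<lambda>n. ?m (r - d (Y n) x)) \<longlongrightarrow> ?m r) F"
    using isCont_tendsto_compose[OF cont] by simp
  have "((\<lambda>n. r + d x (Y n)) \<longlongrightarrow> r + 0) F"
    by (intro tendsto_intros filterlim_compose[OF tendsto_dist_right Y])
  then show "((\<lambda>n. ?m (r + d x (Y n))) \<longlongrightarrow> ?m r) F"
    using isCont_tendsto_compose[OF cont] by simp
  show "\<forall>\<^sub>F n in F. ?m (r - d (Y n) x) \<le> (\<integral>\<^sup>+y\<in>dist_ball d (Y n) r. h y \<partial>\<rho>)"
    using ball_shift by (intro always_eventually allI nn_set_integral_set_mono)
  \<comment> \<open>The outer inclusion is \<open>ball_shift\<close> for the ball about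
    \<open>x\<close> of radius r + d x (Y n); the subtraction there leaves r.\<close>
  show "\<forall>\<^sub>F n in F. (\<integral>\<^sup>+y\<in>dist_ball d (Y n) r. h y \<partial>\<rho>) \<le> ?m (r + d x (Y n))"
    using ball_shift[of "Y n" "r + d x (Y n)" x for n] by (intro always_eventually allI nn_set_integral_set_mono) auto
qed

text \<open>Numerator and denominator are monotone in the radius, hence Borel.\<close>

lemma measurable_ball_average: "ball_average d \<rho> f x \<in> borel_measurable borel"
proof -
  have [measurable]: "(\<lambda>r. \<integral>\<^sup>+y\<in>dist_ball d x r. h y \<partial>\<rho>) \<in> borel_measurable borel" for h
    by (rule borel_measurable_mono_ennreal[OF mono_integral_ball])
  show ?thesis
    unfolding ball_average_def[abs_def] emeasure_ball_eq by measurable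
qed

lemma ball_average_powr_le:
  assumes "f \<in> borel_measurable \<rho>" "(\<integral>\<^sup>+y. ennreal (norm (f y) powr p) \<partial>\<rho>) \<le> ennreal F" "0 < F" "0 < r" "1 \<le> p"
  shows "ennreal_powr (ball_average d \<rho> f x r) p \<le> ennreal (2 powr p * F) / emeasure \<rho> (dist_ball d x r)"
  unfolding ball_average_def using assms by (intro average_powr_le emeasure_ball) auto

text \<open>If the ball has infinite measure, then the average is \<open>0\<close> by the conventions of \<open>ennreal\<close>.\<close>
lemma tendsto_ball_average_powr:
  assumes f: "f \<in> borel_measurable \<rho>" "(\<integral>\<^sup>+y. ennreal (norm (f y) powr p) \<partial>\<rho>) \<le> ennreal F" "0 < F" and r: "0 < r" and p: "1 \<le> p"
    and cont: "isCont (\<lambda>r. \<integral>\<^sup>+y\<in>dist_ball d x r. ennreal (norm (f y)) \<partial>\<rho>) r" "isCont (\<lambda>r. emeasure \<rho> (dist_ball d x r)) r"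
    and Y: "(Y \<longlongrightarrow> x) G"
  shows "((\<lambda>n. ennreal_powr (ball_average d \<rho> f (Y n) r) p) \<longlongrightarrow> ennreal_powr (ball_average d \<rho> f x r) p) G"
proof -
  let ?V = "\<lambda>x. emeasure \<rho> (dist_ball d x r)"
  have V: "((\<lambda>n. ?V (Y n)) \<longlongrightarrow> ?V x) G"
    using tendsto_integral_ball[OF _ Y, of r "\<lambda>_. 1"] cont(2) by (simp flip: emeasure_ball_eq)
  have inv: "((\<lambda>n. inverse (?V (Y n))) \<longlongrightarrow> inverse (?V x)) G"
    using continuous_on_tendsto_compose[OF continuous_on_inverse_ennreal[OF continuous_on_id, of UNIV] V] by auto
  show ?thesis
  proof (cases "?V x = top")
    case True
    \<comment> \<open>The numerator of the average may tend to \<infinity> as well, so the quotient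
      is not treated termwise: the Hoelder bound has a constant finite numerator and squeezes the
      averages to 0.\<close>
    have "((\<lambda>n. ennreal (2 powr p * F) * inverse (?V (Y n))) \<longlongrightarrow> ennreal (2 powr p * F) * inverse (?V x)) G"
      by (intro tendsto_mult_ennreal tendsto_const inv) (use True in auto)
    then have lim0: "((\<lambda>n. ennreal (2 powr p * F) / ?V (Y n)) \<longlongrightarrow> 0) G"
      using True by (simp add: divide_ennreal_def)
    have "((\<lambda>n. ennreal_powr (ball_average d \<rho> f (Y n) r) p) \<longlongrightarrow> 0) G"
    proof (rule tendsto_sandwich[OF _ _ tendsto_const lim0])
      show "\<forall>\<^sub>F n in G. ennreal_powr (ball_average d \<rho> f (Y n) r) p \<le> ennreal (2 powr p * F) / ?V (Y n)"
        using ball_average_powr_le[OF f r p] by simp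
    qed simp
    moreover have "ennreal_powr (ball_average d \<rho> f x r) p = 0"
      using True p by (simp add: ball_average_def ennreal_powr_def)
    ultimately show ?thesis by simp
  next
    case False
    \<comment> \<open>The Hoelder bound makes the average at \<open>x\<close> finite, as
      \<open>tendsto_ennreal_powr\<close> asks.\<close>
    have "ennreal (2 powr p * F) / ?V x < top"
      using emeasure_ball[OF r, of x] by (simp add: less_top[symmetric] ennreal_divide_eq_top_iff)
    then have "ennreal_powr (ball_average d \<rho> f x r) p < top"
      using ball_average_powr_le[OF f r p, of x] by (rule le_less_trans[rotated])
    then have fin: "ball_average d \<rho> f x r \<noteq> top"
      by (auto simp: ennreal_powr_def)
    then have "(\<integral>\<^sup>+y\<in>dist_ball d x r. ennreal (norm (f y)) \<partial>\<rho>) \<noteq> top"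
      using False by (auto simp: ball_average_def ennreal_divide_eq_top_iff)
    then have "((\<lambda>n. ball_average d \<rho> f (Y n) r) \<longlongrightarrow> ball_average d \<rho> f x r) G"
      unfolding ball_average_def divide_ennreal_def
      using emeasure_ball[OF r, of x] False
      by (intro tendsto_mult_ennreal inv tendsto_integral_ball[OF cont(1) Y]) auto
    then show ?thesis
      using fin p by (intro tendsto_ennreal_powr) auto
  qed
qed

text \<open>Provides the dominating function w * K, with K independent of the radius and of the
  centre near \<open>x\<close>. Small balls lie in the set where \<open>f\<close> is essentially
  bounded; the others contain a fixed ball about \<open>x\<close>.\<close>

lemma eventually_ball_average_powr_le:
  fixes f :: "'g \<Rightarrow> 'k::real_normed_field"
  assumes f: "in_Lp \<rho> p f" and p: "1 \<le> p" and x: "ess_bounded_near \<rho> f x"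
  obtains K where "K < top" "\<forall>\<^sub>F y in nhds x. \<forall>r>0. ennreal_powr (ball_average d \<rho> f y r) p \<le> K"
proof -
  obtain U C where U: "open U" "x \<in> U" and C: "AE y in \<rho>. y \<in> U \<longrightarrow> norm (f y) \<le> C"
    using x unfolding ess_bounded_near_def by blast
  obtain \<epsilon> where "0 < \<epsilon>" and \<epsilon>: "dist_ball d x \<epsilon> \<subseteq> U"
    using ball_subset_open[OF U] by blast
  obtain F where F: "0 < F" "(\<integral>\<^sup>+y. ennreal (norm (f y) powr p) \<partial>\<rho>) \<le> ennreal F"
    using in_Lp_obtain_bound[OF f] .
  \<comment> \<open>The first summand serves radii below \<epsilon>/2, the second all other radii.
    Taking the maximum with 0 spares a proof that \<open>C\<close> is nonnegative.\<close>
  define K where "K = ennreal (max C 0 powr p) + ennreal (2 powr p * F) / emeasure \<rho> (dist_ball d x (\<epsilon>/4))"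
  have "K < top"
    using emeasure_ball[of "\<epsilon>/4" x] \<open>0 < \<epsilon>\<close> by (auto simp: K_def less_top[symmetric] ennreal_divide_eq_top_iff)
  \<comment> \<open>With both distances below \<epsilon>/4, a radius r < \<epsilon>/2 satisfies r
    \<le> \<epsilon> - d x y, and a radius r \<ge> \<epsilon>/2 satisfies r - d y x \<ge>
    \<epsilon>/4.\<close>
  moreover have "\<forall>\<^sub>F y in nhds x. d x y < \<epsilon>/4" "\<forall>\<^sub>F y in nhds x. d y x < \<epsilon>/4"
    using order_tendstoD(2)[OF tendsto_dist_right, of "\<epsilon>/4"] order_tendstoD(2)[OF tendsto_dist_left, of "\<epsilon>/4"] \<open>0 < \<epsilon>\<close>
    by auto
  then have "\<forall>\<^sub>F y in nhds x. \<forall>r>0. ennreal_powr (ball_average d \<rho> f y r) p \<le> K"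
  proof (eventually_elim, intro allI impI)
    fix y and r :: real assume y: "d x y < \<epsilon>/4" "d y x < \<epsilon>/4" and "0 < r"
    show "ennreal_powr (ball_average d \<rho> f y r) p \<le> K"
    proof (cases "r < \<epsilon>/2")
      case True
      have "dist_ball d y r \<subseteq> dist_ball d y (\<epsilon> - d x y)"
        using y True \<open>0 < \<epsilon>\<close> by (intro ball_mono) linarith
      also have "\<dots> \<subseteq> U"
        using ball_shift \<epsilon> by blast
      finally have sub: "dist_ball d y r \<subseteq> U" .
      have "(\<integral>\<^sup>+z\<in>dist_ball d y r. ennreal (norm (f z)) \<partial>\<rho>) \<le> (\<integral>\<^sup>+z. ennreal (max C 0) * indicator (dist_ball d y r) z \<partial>\<rho>)"
      proof (intro nn_integral_mono_AE, use C in eventually_elim)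
        case (elim z)
        then show ?case
          using sub by (cases "z \<in> dist_ball d y r") (auto intro!: ennreal_leI)
      qed
      also have "\<dots> = ennreal (max C 0) * emeasure \<rho> (dist_ball d y r)"
        by (simp add: nn_integral_cmult_indicator)
      finally have "ball_average d \<rho> f y r \<le> ennreal (max C 0)"
        unfolding ball_average_def using emeasure_ball[OF \<open>0 < r\<close>, of y]
        by (intro divide_le_posI_ennreal) (auto simp: zero_less_iff_neq_zero mult.commute)
      then have "ennreal_powr (ball_average d \<rho> f y r) p \<le> ennreal_powr (ennreal (max C 0)) p"
        using p by (intro ennreal_powr_mono) auto
      also have "\<dots> \<le> K"
        by (simp add: K_def ennreal_powr_ennreal)
      finally show ?thesis .
    next
      case False
      have "dist_ball d x (\<epsilon>/4) \<subseteq> dist_ball d x (r - d y x)"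
        using y False by (intro ball_mono) linarith
      also have "\<dots> \<subseteq> dist_ball d y r"
        by (rule ball_shift)
      finally have sub: "dist_ball d x (\<epsilon>/4) \<subseteq> dist_ball d y r" .
      have "ennreal_powr (ball_average d \<rho> f y r) p \<le> ennreal (2 powr p * F) / emeasure \<rho> (dist_ball d y r)"
        using f F \<open>0 < r\<close> p by (intro ball_average_powr_le) (auto simp: in_Lp_def)
      also have "\<dots> \<le> ennreal (2 powr p * F) / emeasure \<rho> (dist_ball d x (\<epsilon>/4))"
        unfolding divide_ennreal_def by (intro mult_left_mono inverse_antimono_ennreal emeasure_mono sub) auto
      also have "\<dots> \<le> K"
        by (simp add: K_def)
      finally show ?thesis .
    qed
  qed
  ultimately show thesis by (rule that)
qed

text \<open>The exceptional radii are the discontinuities of two monotone functions, the integral of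
  |f| and the measure over balls about \<open>x\<close>. They form a countable set that does not
  depend on \<open>Y\<close>.\<close>

lemma AE_tendsto_ball_average_powr:
  fixes f :: "'g \<Rightarrow> 'k::real_normed_field"
  assumes f: "in_Lp \<rho> p f" and p: "1 \<le> p" and Y: "(Y \<longlongrightarrow> x) G"
  shows "AE r in lebesgue_on {0<..}. ((\<lambda>n. ennreal_powr (ball_average d \<rho> f (Y n) r) p) \<longlongrightarrow> ennreal_powr (ball_average d \<rho> f x r) p) G"
proof -
  obtain F where F: "0 < F" "(\<integral>\<^sup>+y. ennreal (norm (f y) powr p) \<partial>\<rho>) \<le> ennreal F"
    using in_Lp_obtain_bound[OF f] .
  let ?D = "\<lambda>h. {r. \<not> isCont (\<lambda>r. \<integral>\<^sup>+y\<in>dist_ball d x r. h y \<partial>\<rho>) r}"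
  let ?S = "?D (\<lambda>y. ennreal (norm (f y))) \<union> ?D (\<lambda>_. 1)"
  have "countable ?S"
    by (intro countable_Un mono_ennreal_countable_discont mono_integral_ball)
  then have "AE r in lborel. r \<notin> ?S"
    by (intro AE_not_in countable_imp_null_set_lborel)
  then have "AE r in lebesgue. r \<notin> ?S"
    by (rule AE_completion)
  then have "AE r in lebesgue. r \<in> {0<..} \<longrightarrow> r \<notin> ?S"
    by eventually_elim blast
  then have "AE r in lebesgue_on {0<..}. r \<notin> ?S"
    by (subst AE_restrict_space_iff) simp_all
  from this AE_space show ?thesis
  proof eventually_elim
    case (elim r)
    then have "0 < r" by (simp add: space_restrict_space)
    then show ?case
      using f F p Y elim by (intro tendsto_ball_average_powr[where F = F]) (auto simp: in_Lp_def)
  qed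
qed

theorem isCont_I_op:
  fixes f :: "'g \<Rightarrow> 'k::real_normed_field"
  assumes w: "radius_weight w" and f: "in_Lp \<rho> p f" and p: "1 \<le> p" and x: "ess_bounded_near \<rho> f x"
  shows "isCont (I_op d \<rho> p w f) x"
proof -
  let ?M = "lebesgue_on {0<..} :: real measure"
  let ?g = "\<lambda>y r. ennreal (w r) * ennreal_powr (ball_average d \<rho> f y r) p"
  obtain K where K: "K < top" and bound: "\<forall>\<^sub>F y in nhds x. \<forall>r>0. ennreal_powr (ball_average d \<rho> f y r) p \<le> K"
    using eventually_ball_average_powr_le[OF f p x] .
  have [measurable]: "w \<in> borel_measurable ?M" and w_fin: "(\<integral>\<^sup>+r. ennreal (w r) \<partial>?M) < top"
    using w by (auto simp: radius_weight_def)
  have [measurable]: "ball_average d \<rho> f y \<in> borel_measurable ?M" for y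
    using measurable_ball_average by (intro measurable_restrict_space1 measurable_completion) auto
  have dom: "(\<integral>\<^sup>+r. ennreal (w r) * K \<partial>?M) < top"
    using w_fin K by (simp add: nn_integral_multc ennreal_mult_less_top)
  \<comment> \<open>Dominated convergence is a statement about sequences; they suffice for
    continuity because the space is first countable.\<close>
  have lim: "(\<lambda>n. \<integral>\<^sup>+r. ?g (Y n) r \<partial>?M) \<longlonglongrightarrow> (\<integral>\<^sup>+r. ?g x r \<partial>?M)" if Y: "Y \<longlonglongrightarrow> x" for Y
  proof -
    \<comment> \<open>The bound holds only for centres near \<open>x\<close>, hence the passage to a
      tail of the sequence.\<close>
    obtain N where N: "\<And>n. N \<le> n \<Longrightarrow> \<forall>r>0. ennreal_powr (ball_average d \<rho> f (Y n) r) p \<le> K"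
      using eventually_compose_filterlim[OF bound Y] by (auto simp: eventually_sequentially)
    have "(\<lambda>n. \<integral>\<^sup>+r. ?g (Y (n + N)) r \<partial>?M) \<longlonglongrightarrow> (\<integral>\<^sup>+r. ?g x r \<partial>?M)"
    proof (rule nn_integral_dominated_convergence)
      show "AE r in ?M. ?g (Y (n + N)) r \<le> ennreal (w r) * K" for n
        using N[of "n + N"] by (intro AE_I2 mult_left_mono) (auto simp: space_restrict_space)
      have "(\<lambda>n. Y (n + N)) \<longlonglongrightarrow> x"
        using Y by (rule LIMSEQ_ignore_initial_segment)
      from AE_tendsto_ball_average_powr[OF f p this] AE_space
      show "AE r in ?M. (\<lambda>n. ?g (Y (n + N)) r) \<longlonglongrightarrow> ?g x r"
      proof eventually_elim
        case (elim r)
        then have "ennreal_powr (ball_average d \<rho> f x r) p < top"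
          using eventually_nhds_x_imp_x[OF bound] K by (auto simp: space_restrict_space intro: le_less_trans)
        then show ?case
          by (intro tendsto_mult_ennreal tendsto_const elim) auto
      qed
    qed (use dom in auto)
    then show ?thesis by (rule LIMSEQ_offset)
  qed
  \<comment> \<open>Finiteness of the integral at \<open>x\<close> is what the outer power 1 / p
    needs for continuity.\<close>
  have "(\<integral>\<^sup>+r. ?g x r \<partial>?M) \<le> (\<integral>\<^sup>+r. ennreal (w r) * K \<partial>?M)"
    using eventually_nhds_x_imp_x[OF bound]
    by (intro nn_integral_mono mult_left_mono) (auto simp: space_restrict_space)
  then have "(\<integral>\<^sup>+r. ?g x r \<partial>?M) \<noteq> \<infinity>"
    using dom by (auto simp: top_unique)
  then show ?thesis
    unfolding isCont_def tendsto_at_iff_sequentially comp_def I_op_def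
    using lim p by (auto intro!: tendsto_ennreal_powr)
qed

end

section \<open>Riemannian metrics in charts\<close>

text \<open>Reduces the continuity of the metric along varying vectors, and the quadratic form of
  the Gram matrix, to the entries on the standard basis.\<close>

lemma bilinear_vec_expand:
  fixes h :: "real ^ 'n::finite \<Rightarrow> real ^ 'n \<Rightarrow> real"
  assumes "bilinear h"
  shows "h v w = (\<Sum>(i, j)\<in>UNIV. v $ i * w $ j * h (axis i 1) (axis j 1))"
proof -
  have "h v w = h (\<Sum>i\<in>UNIV. v $ i *s axis i 1) (\<Sum>i\<in>UNIV. w $ i *s axis i 1)"
    by (simp add: basis_expansion)
  also have "\<dots> = (\<Sum>(i, j)\<in>UNIV. v $ i * w $ j * h (axis i 1) (axis j 1))"
    unfolding bilinear_sum[OF assms] scalar_mult_eq_scaleR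
    by (simp add: bilinear_lmul[OF assms] bilinear_rmul[OF assms] mult_ac)
  finally show ?thesis .
qed

text \<open>All matrices on the segment from the identity to \<open>G\<close> are invertible, so the determinant keeps its sign.\<close>
lemma det_pos_if_positive_definite:
  fixes G :: "real ^ 'n ^ 'n"
  assumes "\<And>v. v \<noteq> 0 \<Longrightarrow> 0 < v \<bullet> (G *v v)"
  shows "0 < det G"
proof (rule ccontr)
  let ?H = "\<lambda>t::real. (1 - t) *\<^sub>R mat 1 + t *\<^sub>R G"
  assume neg: "\<not> 0 < det G"
  have cont: "continuous_on {0..1} (\<lambda>t. det (?H t))"
    unfolding det_def by (intro continuous_intros)
  have "\<exists>t\<ge>0. t \<le> 1 \<and> det (?H t) = 0"
    using IVT2'[of "\<lambda>t. det (?H t)" 1 0 0] cont neg by auto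
  then obtain t where t: "0 \<le> t" "t \<le> 1" "det (?H t) = 0" by blast
  then obtain v where v: "v \<noteq> 0" "?H t *v v = 0"
    using invertible_det_nz[of "?H t"] invertible_left_inverse[of "?H t"] matrix_left_invertible_ker[of "?H t"] by auto
  \<comment> \<open>On the kernel vector the quadratic form of \<open>?H t\<close> is 0, yet it is a
    convex combination of two positive numbers.\<close>
  have "0 = v \<bullet> (?H t *v v)"
    using v by simp
  also have "\<dots> = (1 - t) * (v \<bullet> v) + t * (v \<bullet> (G *v v))"
    by (simp add: matrix_vector_mult_add_rdistrib inner_add_right scaleR_matrix_vector_assoc[symmetric])
  also have "\<dots> > 0"
    using t v assms[OF v(1)] by (cases "t = 1") (auto intro: add_pos_nonneg)
  finally show False by simp
qed

section \<open>Charts as homeomorphisms and the metric in coordinates\<close>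

locale riemannian_atlas =
  fixes A :: "('g::t2_space, 'n::finite) chart set" and g :: "('g, 'n) metric_tensor"
  assumes atlas: "smooth_atlas A" and metric: "riemannian_metric A g"
begin

lemma chart_at: obtains c where "c \<in> A" "x \<in> fst c"
  using atlas unfolding smooth_atlas_def by blast

context
  fixes c assumes c: "c \<in> A"
begin

lemma is_chart: "is_chart c"
  using atlas c by (simp add: smooth_atlas_def)

lemma open_chart: "open (fst c)" and open_chart_image: "open (chart_image c)"
  using is_chart by (simp_all add: is_chart_def)

lemma continuous_on_chart: "continuous_on (fst c) (snd c)"
  and continuous_on_coord_inv: "continuous_on (chart_image c) (coord_inv c)"
  and coord_inv_chart: "y \<in> fst c \<Longrightarrow> coord_inv c (snd c y) = y"
  and chart_coord_inv: "a \<in> chart_image c \<Longrightarrow> snd c (coord_inv c a) = a"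
  and coord_inv_in: "a \<in> chart_image c \<Longrightarrow> coord_inv c a \<in> fst c"
  and chart_in: "y \<in> fst c \<Longrightarrow> snd c y \<in> chart_image c"
  using is_chart by (auto simp: is_chart_def homeomorphism_def)

text \<open>The image under the inverse map is a preimage under the continuous map
  \<open>snd c\<close>.\<close>

lemma open_coord_inv_image:
  assumes "open B" "B \<subseteq> chart_image c"
  shows "open (coord_inv c ` B)"
proof -
  have "coord_inv c ` B = fst c \<inter> snd c -` B"
    using assms(2) by (auto simp: coord_inv_in chart_coord_inv image_iff subset_eq) (metis coord_inv_chart)
  then show ?thesis
    using continuous_open_preimage[OF continuous_on_chart open_chart assms(1)] by simp
qed

lemma open_chart_image_of:
  assumes "open V" "V \<subseteq> fst c"
  shows "open (snd c ` V)"
proof -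
  have "snd c ` V = chart_image c \<inter> coord_inv c -` V"
    using assms(2) by (auto simp: chart_in coord_inv_chart image_iff subset_eq) (metis chart_coord_inv)
  then show ?thesis
    using continuous_open_preimage[OF continuous_on_coord_inv open_chart_image assms(1)] by simp
qed

lemma bilinear_metric: "x \<in> fst c \<Longrightarrow> bilinear (g c x)"
  and metric_pos: "x \<in> fst c \<Longrightarrow> v \<noteq> 0 \<Longrightarrow> 0 < g c x v v"
  using metric c by (auto simp: riemannian_metric_def)

lemma metric_scale: "x \<in> fst c \<Longrightarrow> g c x (m *\<^sub>R v) (m *\<^sub>R v) = m\<^sup>2 * g c x v v"
  by (simp add: bilinear_lmul[OF bilinear_metric] bilinear_rmul[OF bilinear_metric] power2_eq_square)

lemma metric_zero: "x \<in> fst c \<Longrightarrow> g c x 0 0 = 0"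
  using metric_scale[of x 0 0] by simp

lemma metric_nonneg: "x \<in> fst c \<Longrightarrow> 0 \<le> g c x v v"
  using metric_pos[of x v] metric_zero[of x] by (cases "v = 0") auto

text \<open>Smoothness of the metric is given in coordinates, so \<open>\<gamma>\<close> is
  rewritten as \<open>coord_inv c\<close> applied to its coordinates.\<close>

lemma continuous_on_metric_const:
  assumes "continuous_on X \<gamma>" "\<gamma> ` X \<subseteq> fst c"
  shows "continuous_on X (\<lambda>s. g c (\<gamma> s) v w)"
proof -
  have "Ck_on 0 (chart_image c) (\<lambda>a. g c (coord_inv c a) v w)"
    using metric c unfolding riemannian_metric_def smooth_map_on_def by blast
  then have "continuous_on (chart_image c) (\<lambda>a. g c (coord_inv c a) v w)"
    by simp
  moreover have "continuous_on X (\<lambda>s. snd c (\<gamma> s))"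
    by (rule continuous_on_compose2[OF continuous_on_chart assms])
  ultimately have "continuous_on X (\<lambda>s. g c (coord_inv c (snd c (\<gamma> s))) v w)"
    by (rule continuous_on_compose2) (use assms(2) chart_in in auto)
  then show ?thesis
    using assms(2) by (subst continuous_on_cong[OF refl, of X _ "\<lambda>s. g c (coord_inv c (snd c (\<gamma> s))) v w"])
      (auto simp: coord_inv_chart)
qed

lemma continuous_on_metric:
  assumes "continuous_on X \<gamma>" "\<gamma> ` X \<subseteq> fst c" "continuous_on X D"
  shows "continuous_on X (\<lambda>s. g c (\<gamma> s) (D s) (D s))"
proof -
  have "continuous_on X (\<lambda>s. \<Sum>(i, j)\<in>UNIV. D s $ i * D s $ j * g c (\<gamma> s) (axis i 1) (axis j 1))"
    unfolding split_def
    by (intro continuous_intros continuous_on_metric_const assms)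
  moreover have "g c (\<gamma> s) (D s) (D s) = (\<Sum>(i, j)\<in>UNIV. D s $ i * D s $ j * g c (\<gamma> s) (axis i 1) (axis j 1))"
    if "s \<in> X" for s
    using that assms(2) by (intro bilinear_vec_expand bilinear_metric) auto
  ultimately show ?thesis
    by (simp cong: continuous_on_cong)
qed

text \<open>The continuous positive function sqrt (g v v) attains its minimum and maximum on
  \<open>K\<close> times the unit sphere; homogeneity extends the bounds to all \<open>v\<close>.
  The upper bound later yields short connecting curves, the lower bound confines short
  curves.\<close>

lemma metric_bounds_compact:
  assumes K: "compact K" "K \<noteq> {}" "K \<subseteq> chart_image c"
  obtains l L where "0 < l" "0 < L"
    "\<And>a v. a \<in> K \<Longrightarrow> l * norm v \<le> sqrt (g c (coord_inv c a) v v)"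
    "\<And>a v. a \<in> K \<Longrightarrow> sqrt (g c (coord_inv c a) v v) \<le> L * norm v"
proof -
  let ?q = "\<lambda>z. sqrt (g c (coord_inv c (fst z)) (snd z) (snd z))"
  let ?X = "K \<times> sphere (0 :: real ^ 'n) 1"
  have cpt: "compact ?X"
    using K by (intro compact_Times) auto
  have ne: "?X \<noteq> {}"
    using K norm_axis_1 by (fastforce simp: ex_in_conv[symmetric])
  have sub: "coord_inv c a \<in> fst c" if "a \<in> K" for a
    using that K coord_inv_in by blast
  have cont: "continuous_on ?X ?q"
  proof (intro continuous_on_real_sqrt continuous_on_metric)
    show "continuous_on ?X (\<lambda>z. coord_inv c (fst z))"
      by (rule continuous_on_compose2[OF continuous_on_coord_inv]) (use K in \<open>auto intro: continuous_intros\<close>)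
  qed (use sub in \<open>auto intro: continuous_intros\<close>)
  obtain z where z: "z \<in> ?X" and zmin: "\<And>y. y \<in> ?X \<Longrightarrow> ?q z \<le> ?q y"
    using continuous_attains_inf[OF cpt ne cont] by blast
  obtain y where y: "y \<in> ?X" and ymax: "\<And>z. z \<in> ?X \<Longrightarrow> ?q z \<le> ?q y"
    using continuous_attains_sup[OF cpt ne cont] by blast
  have pos: "0 < ?q z" if "z \<in> ?X" for z
    using that sub by (auto intro!: metric_pos)
  have scale: "sqrt (g c (coord_inv c a) v v) = ?q (a, v /\<^sub>R norm v) * norm v" if "a \<in> K" for a v
    using sub[OF that] by (cases "v = 0") (simp_all add: metric_zero metric_scale real_sqrt_mult real_sqrt_divide power_inverse divide_inverse real_sqrt_inverse)
  have "?q z * norm v \<le> sqrt (g c (coord_inv c a) v v) \<and> sqrt (g c (coord_inv c a) v v) \<le> ?q y * norm v"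
    if a: "a \<in> K" for a v
  proof (cases "v = 0")
    case True
    then show ?thesis using sub[OF a] by (simp add: metric_zero)
  next
    case False
    then have "(a, v /\<^sub>R norm v) \<in> ?X" using a by simp
    from zmin[OF this] ymax[OF this] show ?thesis
      unfolding scale[OF a] by (intro conjI mult_right_mono) simp_all
  qed
  note bounds = conjunct1[OF this] conjunct2[OF this]
  show thesis
    by (rule that[OF pos[OF z] pos[OF y]]) (erule bounds)+
qed

end

section \<open>Change of charts and the speed of a curve\<close>

lemma transition_smooth:
  assumes "c \<in> A" "c' \<in> A"
  defines "W \<equiv> chart_image c \<inter> coord_inv c -` fst c'"
  shows "open W"
    and "a \<in> W \<Longrightarrow> ((snd c' \<circ> coord_inv c) has_derivative frechet_derivative (snd c' \<circ> coord_inv c) (at a)) (at a)"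
    and "continuous_on W (\<lambda>a. frechet_derivative (snd c' \<circ> coord_inv c) (at a) v)"
proof -
  show "open W"
    unfolding W_def by (intro continuous_open_preimage continuous_on_coord_inv open_chart_image open_chart assms)
  \<comment> \<open>This identifies the domain used in \<open>smooth_atlas\<close> with a preimage,
    whose openness was just shown.\<close>
  have W: "W = snd c ` (fst c \<inter> fst c')"
  proof (intro equalityI subsetI)
    fix a assume "a \<in> W"
    then show "a \<in> snd c ` (fst c \<inter> fst c')"
      using assms(1) unfolding W_def
      by (intro image_eqI[of _ _ "coord_inv c a"]) (auto simp: chart_coord_inv coord_inv_in)
  qed (use assms(1) in \<open>auto simp: W_def chart_in coord_inv_chart\<close>)
  have trans: "\<forall>c\<in>A. \<forall>c'\<in>A. smooth_map_on (snd c ` (fst c \<inter> fst c')) (snd c' \<circ> coord_inv c)"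
    using atlas by (simp add: smooth_atlas_def)
  have "smooth_map_on W (snd c' \<circ> coord_inv c)"
    unfolding W by (rule trans[rule_format, OF assms(1,2)])
  then have "Ck_on (Suc 0) W (snd c' \<circ> coord_inv c)"
    unfolding smooth_map_on_def by (rule spec)
  then have Ck: "(snd c' \<circ> coord_inv c) differentiable_on W"
      "\<forall>v. continuous_on W (\<lambda>a. frechet_derivative (snd c' \<circ> coord_inv c) (at a) v)"
    unfolding Ck_on.simps by blast+
  from Ck(2) show "continuous_on W (\<lambda>a. frechet_derivative (snd c' \<circ> coord_inv c) (at a) v)"
    by (rule spec)
  assume "a \<in> W"
  then have "(snd c' \<circ> coord_inv c) differentiable (at a)"
    using Ck(1) \<open>open W\<close> unfolding differentiable_on_def by (metis at_within_open)
  then show "((snd c' \<circ> coord_inv c) has_derivative frechet_derivative (snd c' \<circ> coord_inv c) (at a)) (at a)"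
    by (simp add: frechet_derivative_works)
qed

text \<open>Quantifying over all charts makes the value independent of the chart that
  \<open>SOME\<close> picks in \<open>speed\<close>, and includes the existence of a two-sided
  derivative.\<close>

definition has_speed :: "(real \<Rightarrow> 'g) \<Rightarrow> real \<Rightarrow> real \<Rightarrow> bool" where
  "has_speed \<gamma> t s \<longleftrightarrow> (\<forall>c\<in>A. \<gamma> t \<in> fst c \<longrightarrow>
     (\<exists>v. ((snd c \<circ> \<gamma>) has_vector_derivative v) (at t) \<and> s = sqrt (g c (\<gamma> t) v v)))"

lemma some_chart:
  "(SOME c. c \<in> A \<and> x \<in> fst c) \<in> A" "x \<in> fst (SOME c. c \<in> A \<and> x \<in> fst c)"
  using someI_ex[of "\<lambda>c. c \<in> A \<and> x \<in> fst c"] chart_at[of x] by blast+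

lemma speed_nonneg: "0 \<le> speed A g \<gamma> t"
  unfolding speed_def Let_def using some_chart by (simp add: metric_nonneg)

lemma speed_eq: "has_speed \<gamma> t s \<Longrightarrow> speed A g \<gamma> t = s"
  unfolding has_speed_def speed_def Let_def using some_chart[of "\<gamma> t"] by (auto dest!: bspec vector_derivative_at)

text \<open>One chart suffices: the chain rule transports the velocity through the transition map,
  and the transformation law, \<open>preserves_metric\<close> for \<open>id\<close>, keeps its
  length.\<close>

lemma has_speedI:
  assumes c: "c \<in> A" and cont: "isCont \<gamma> t" and t: "\<gamma> t \<in> fst c"
    and v: "((snd c \<circ> \<gamma>) has_vector_derivative v) (at t)"
  shows "has_speed \<gamma> t (sqrt (g c (\<gamma> t) v v))"
  unfolding has_speed_def
proof (intro ballI impI)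
  fix c' assume c': "c' \<in> A" "\<gamma> t \<in> fst c'"
  let ?T = "snd c' \<circ> coord_inv c" and ?a = "snd c (\<gamma> t)"
  have "?a \<in> chart_image c \<inter> coord_inv c -` fst c'"
    using c t c' by (simp add: chart_in coord_inv_chart)
  from transition_smooth(2)[OF c c'(1) this]
  have "(?T has_derivative frechet_derivative ?T (at ?a)) (at ((snd c \<circ> \<gamma>) t) within range (snd c \<circ> \<gamma>))"
    by (auto intro: has_derivative_at_withinI)
  from vector_derivative_diff_chain_within[OF v this]
  have "((?T \<circ> (snd c \<circ> \<gamma>)) has_vector_derivative frechet_derivative ?T (at ?a) v) (at t)" .
  \<comment> \<open>By continuity the curve stays in the domain of \<open>c\<close> near
    \<open>t\<close>; only there can its coordinates in \<open>c'\<close> be computed through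
    \<open>c\<close>.\<close>
  moreover have ev: "\<forall>\<^sub>F s in nhds t. \<gamma> s \<in> fst c"
    using cont open_chart[OF c] t by (auto simp: isCont_def tendsto_def eventually_at_filter elim!: eventually_mono dest!: spec[of _ "fst c"])
  have "\<forall>\<^sub>F s in nhds t. (?T \<circ> (snd c \<circ> \<gamma>)) s = (snd c' \<circ> \<gamma>) s"
    using ev by eventually_elim (use c in \<open>simp add: coord_inv_chart\<close>)
  ultimately have "((snd c' \<circ> \<gamma>) has_vector_derivative frechet_derivative ?T (at ?a) v) (at t)"
    using c t by (subst (asm) has_vector_derivative_cong_ev) (auto simp: coord_inv_chart elim: eventually_mono)
  moreover have "g c (\<gamma> t) v v = g c' (\<gamma> t) (frechet_derivative ?T (at ?a) v) (frechet_derivative ?T (at ?a) v)"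
  proof -
    have "preserves_metric A g id"
      using metric unfolding riemannian_metric_def by (elim conjE)
    from this[unfolded preserves_metric_def, rule_format, OF c c'(1), of "\<gamma> t" v v]
    show ?thesis
      using t c'(2) by (simp only: chart_differential_def id_apply comp_id simp_thms)
  qed
  ultimately show "\<exists>v'. ((snd c' \<circ> \<gamma>) has_vector_derivative v') (at t) \<and> sqrt (g c (\<gamma> t) v v) = sqrt (g c' (\<gamma> t) v' v')"
    by auto
qed

text \<open>Prepared for the two halves of a joined path, which agree with a rescaled curve only
  locally. Positivity of \<open>m\<close> makes the square root of its square equal to
  \<open>m\<close>.\<close>

lemma has_speed_affine:
  assumes s: "has_speed \<gamma> (m * t + k) s"
    and ev: "\<forall>\<^sub>F u in nhds t. \<eta> u = \<gamma> (m * u + k)"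
    and m: "0 < m"
  shows "has_speed \<eta> t (m * s)"
  unfolding has_speed_def
proof (intro ballI impI)
  fix c assume c: "c \<in> A" "\<eta> t \<in> fst c"
  have t: "\<eta> t = \<gamma> (m * t + k)"
    using ev by (rule eventually_nhds_x_imp_x)
  obtain v where v: "((snd c \<circ> \<gamma>) has_vector_derivative v) (at (m * t + k))" "s = sqrt (g c (\<eta> t) v v)"
    using s c t unfolding has_speed_def by auto
  have "((\<lambda>u. m * u + k) has_vector_derivative m) (at t)"
    by (auto intro!: derivative_eq_intros simp: has_real_derivative_iff_has_vector_derivative[symmetric])
  from vector_diff_chain_at[OF this v(1)]
  have "((snd c \<circ> \<gamma> \<circ> (\<lambda>u. m * u + k)) has_vector_derivative m *\<^sub>R v) (at t)"
    by (simp add: comp_def)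
  then have "((snd c \<circ> \<eta>) has_vector_derivative m *\<^sub>R v) (at t)"
    using ev t by (subst has_vector_derivative_cong_ev[where g = "snd c \<circ> \<gamma> \<circ> (\<lambda>u. m * u + k)"]) (auto elim: eventually_mono)
  moreover have "m * s = sqrt (g c (\<eta> t) (m *\<^sub>R v) (m *\<^sub>R v))"
    using c m v(2) by (simp add: metric_scale real_sqrt_mult)
  ultimately show "\<exists>v. ((snd c \<circ> \<eta>) has_vector_derivative v) (at t) \<and> m * s = sqrt (g c (\<eta> t) v v)"
    by blast
qed

end

section \<open>Lengths of piecewise smooth curves\<close>

text \<open>Induction on the number of partition points below \<open>b\<close>: the piece from the
  largest of them, \<open>m\<close>, to \<open>b\<close> is split off.\<close>

lemma partition_induct:
  fixes S :: "real set"
  assumes S: "finite S" "a \<in> S" "b \<in> S" "a < b"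
    and step: "\<And>u v. u \<in> S \<Longrightarrow> v \<in> S \<Longrightarrow> u < v \<Longrightarrow> S \<inter> {u<..<v} = {} \<Longrightarrow> P u v"
    and join: "\<And>u v w. u < v \<Longrightarrow> v < w \<Longrightarrow> P u v \<Longrightarrow> P v w \<Longrightarrow> P u w"
  shows "P a b"
  using S(3,4)
proof (induction "card {s \<in> S. s < b}" arbitrary: b rule: less_induct)
  case less
  let ?L = "{s \<in> S. s < b}"
  define m where "m = Max ?L"
  have fin: "finite ?L" and "a \<in> ?L" using less.prems S by auto
  then have m: "m \<in> ?L" "a \<le> m" unfolding m_def using Max_in by (blast, auto)
  have "S \<inter> {m<..<b} = {}"
    using Max_ge[OF fin] by (force simp: m_def[symmetric])
  then have mb: "P m b"
    using m less.prems by (intro step) auto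
  show ?case
  proof (cases "a = m")
    case False
    have "{s \<in> S. s < m} \<subset> ?L" using m by auto
    then have "card {s \<in> S. s < m} < card ?L"
      using fin by (rule psubset_card_mono[rotated])
    then have "P a m"
      using less.hyps[of m] m False by auto
    then show ?thesis using join[of a m b] m mb False by auto
  qed (use mb in simp)
qed

text \<open>The witnesses are the partition points nearest to \<open>t\<close> on either
  side.\<close>

lemma partition_piece:
  fixes S :: "real set"
  assumes "finite S" "a \<in> S" "b \<in> S" "a < t" "t < b" "t \<notin> S"
  obtains u v where "u \<in> S" "v \<in> S" "u < t" "t < v" "S \<inter> {u<..<v} = {}"
proof -
  let ?L = "{s \<in> S. s < t}" and ?R = "{s \<in> S. t < s}"
  have "finite ?L" "finite ?R" "?L \<noteq> {}" "?R \<noteq> {}" using assms by auto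
  then have "Max ?L \<in> ?L" "Min ?R \<in> ?R" "\<And>s. s \<in> ?L \<Longrightarrow> s \<le> Max ?L" "\<And>s. s \<in> ?R \<Longrightarrow> Min ?R \<le> s"
    by (auto simp: Max_in Min_in simp del: mem_Collect_eq)
  then show thesis
    using assms(6) by (intro that[of "Max ?L" "Min ?R"]) (auto, metis linorder_neqE not_le)
qed

lemma finite_vimage_double:
  fixes S :: "real set"
  assumes "finite S"
  shows "finite {t. 2 * t + k \<in> S}"
  using finite_vimageI[OF assms, of "\<lambda>t. 2 * t + k"] by (simp add: inj_def vimage_def)

context riemannian_atlas
begin

section \<open>Speed and concatenation of piecewise C1 curves\<close>

lemma C1_curve_on_derivE:
  assumes "C1_curve_on A a b \<gamma>" "c \<in> A"
  obtains D where "continuous_on {t \<in> {a..b}. \<gamma> t \<in> fst c} D"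
    "\<forall>t\<in>{a..b}. \<gamma> t \<in> fst c \<longrightarrow> ((snd c \<circ> \<gamma>) has_vector_derivative D t) (at t within {a..b})"
  using bspec[OF conjunct2[OF assms(1)[unfolded C1_curve_on_def]] assms(2)] by (elim exE conjE)

lemma C1_curve_has_speed:
  assumes "C1_curve_on A a b \<gamma>" "a < t" "t < b"
  shows "\<exists>s. has_speed \<gamma> t s"
proof -
  obtain c where c: "c \<in> A" "\<gamma> t \<in> fst c" using chart_at .
  then obtain D where "((snd c \<circ> \<gamma>) has_vector_derivative D) (at t within {a..b})"
    using assms unfolding C1_curve_on_def by fastforce
  then have "((snd c \<circ> \<gamma>) has_vector_derivative D) (at t)"
    using assms by (simp add: at_within_Icc_at)
  moreover have "isCont \<gamma> t"
    using assms by (auto simp: C1_curve_on_def intro: continuous_on_interior)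
  ultimately show ?thesis using has_speedI c by blast
qed

text \<open>A short enough subinterval is mapped into a single chart, where the speed agrees with a
  continuous function up to finitely many points. Compactness of the interval makes this local
  property global.\<close>

lemma C1_curve_speed_integrable:
  assumes \<gamma>: "C1_curve_on A a b \<gamma>"
  shows "speed A g \<gamma> integrable_on {a..b}"
proof -
  have cont: "continuous_on {a..b} \<gamma>" using \<gamma> by (simp add: C1_curve_on_def)
  have "\<exists>e>0. \<forall>u v. t \<in> {u..v} \<and> {u..v} \<subseteq> ball t e \<and> {u..v} \<subseteq> {a..b} \<longrightarrow> speed A g \<gamma> integrable_on {u..v}"
    if t: "t \<in> {a..b}" for t
  proof -
    obtain c where c: "c \<in> A" "\<gamma> t \<in> fst c" using chart_at .
    obtain D where D: "continuous_on {t \<in> {a..b}. \<gamma> t \<in> fst c} D"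
      and deriv: "\<forall>t\<in>{a..b}. \<gamma> t \<in> fst c \<longrightarrow> ((snd c \<circ> \<gamma>) has_vector_derivative D t) (at t within {a..b})"
      using C1_curve_on_derivE[OF \<gamma> c(1)] .
    obtain T where T: "open T" "{a..b} \<inter> \<gamma> -` fst c = T \<inter> {a..b}"
      using cont open_chart[OF c(1)] unfolding continuous_on_open_invariant by (metis Int_commute)
    then have "t \<in> T" using t c by blast
    then obtain e where "0 < e" and e: "ball t e \<subseteq> T"
      using T(1) open_contains_ball by blast
    have "speed A g \<gamma> integrable_on {u..v}" if uv: "{u..v} \<subseteq> ball t e" "{u..v} \<subseteq> {a..b}" for u v
    proof -
      have sub: "{u..v} \<subseteq> {t \<in> {a..b}. \<gamma> t \<in> fst c}"
        using uv e T by blast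
      have "continuous_on {u..v} (\<lambda>s. sqrt (g c (\<gamma> s) (D s) (D s)))"
        using sub by (intro continuous_on_real_sqrt continuous_on_metric[OF c(1)] continuous_on_subset[OF cont] continuous_on_subset[OF D]) auto
      then have "(\<lambda>s. sqrt (g c (\<gamma> s) (D s) (D s))) integrable_on {u..v}"
        by (rule integrable_continuous_interval)
      then show ?thesis
      proof (rule integrable_spike_finite[rotated 2])
        \<comment> \<open>At the end points \<open>C1_curve_on\<close> gives only one-sided
          derivatives, whereas \<open>speed\<close> uses the two-sided one.\<close>
        show "finite {a, b}" by simp
        fix s assume "s \<in> {u..v} - {a, b}"
        then have s: "s \<in> {a<..<b}" "\<gamma> s \<in> fst c" using sub by fastforce+
        then have "((snd c \<circ> \<gamma>) has_vector_derivative D s) (at s)"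
          using deriv[rule_format, of s] by (simp add: at_within_Icc_at)
        moreover have "isCont \<gamma> s"
          using cont s by (auto intro: continuous_on_interior)
        ultimately show "speed A g \<gamma> s = sqrt (g c (\<gamma> s) (D s) (D s))"
          using c s by (intro speed_eq has_speedI) auto
      qed
    qed
    then show ?thesis using \<open>0 < e\<close> by blast
  qed
  then show ?thesis
    using integrable_on_little_subintervals[of a b "speed A g \<gamma>"] by simp
qed

lemma piecewise_C1_curve_partition:
  assumes "piecewise_C1_curve A \<gamma>"
  obtains S where "finite S" "0 \<in> S" "1 \<in> S" "S \<subseteq> {0..1}"
    "\<And>a b. a \<in> S \<Longrightarrow> b \<in> S \<Longrightarrow> a < b \<Longrightarrow> S \<inter> {a<..<b} = {} \<Longrightarrow> C1_curve_on A a b \<gamma>"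
proof -
  obtain S where S: "finite S" "{0, 1} \<subseteq> S" "S \<subseteq> {0..1}"
    and C1: "\<forall>a\<in>S. \<forall>b\<in>S. a < b \<and> S \<inter> {a<..<b} = {} \<longrightarrow> C1_curve_on A a b \<gamma>"
    using assms unfolding piecewise_C1_curve_def by (elim exE conjE)
  show thesis
    by (rule that[OF S(1) _ _ S(3) C1[rule_format, OF _ _ conjI]]) (use S(2) in simp_all)
qed

lemma piecewise_C1_curveE:
  assumes "piecewise_C1_curve A \<gamma>"
  obtains S where "finite S" "\<forall>t\<in>{0..1} - S. has_speed \<gamma> t (speed A g \<gamma> t)"
    "continuous_on {0..1} \<gamma>" "speed A g \<gamma> integrable_on {0..1}"
proof -
  obtain S where S: "finite S" "0 \<in> S" "1 \<in> S" "S \<subseteq> {0..1}"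
    and C1: "\<And>a b. a \<in> S \<Longrightarrow> b \<in> S \<Longrightarrow> a < b \<Longrightarrow> S \<inter> {a<..<b} = {} \<Longrightarrow> C1_curve_on A a b \<gamma>"
    using piecewise_C1_curve_partition[OF assms] by metis
  show thesis
  proof
    show "finite S" by fact
    show "\<forall>t\<in>{0..1} - S. has_speed \<gamma> t (speed A g \<gamma> t)"
    proof
      fix t assume "t \<in> {0..1} - S"
      then have "0 < t" "t < 1" "t \<notin> S" using S by (auto simp: less_le)
      then obtain u v where "u \<in> S" "v \<in> S" "u < t" "t < v" "S \<inter> {u<..<v} = {}"
        using partition_piece[of S 0 1 t] S by blast
      then have "\<exists>s. has_speed \<gamma> t s"
        using C1[of u v] by (intro C1_curve_has_speed) auto
      then show "has_speed \<gamma> t (speed A g \<gamma> t)" using speed_eq by blast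
    qed
    show "continuous_on {0..1} \<gamma>"
    proof (rule partition_induct[OF S(1-3), where P = "\<lambda>a b. continuous_on {a..b} \<gamma>"])
      fix u v w :: real assume "u < v" "v < w" "continuous_on {u..v} \<gamma>" "continuous_on {v..w} \<gamma>"
      then show "continuous_on {u..w} \<gamma>"
        using continuous_on_closed_Un[of "{u..v}" "{v..w}" \<gamma>] by (simp add: ivl_disj_un_two_touch)
    qed (use C1 in \<open>auto simp: C1_curve_on_def\<close>)
    show "speed A g \<gamma> integrable_on {0..1}"
    proof (rule partition_induct[OF S(1-3), where P = "\<lambda>a b. speed A g \<gamma> integrable_on {a..b}"])
      fix u v w :: real assume "u < v" "v < w" "speed A g \<gamma> integrable_on {u..v}" "speed A g \<gamma> integrable_on {v..w}"
      then show "speed A g \<gamma> integrable_on {u..w}"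
        by (intro Henstock_Kurzweil_Integration.integrable_combine[of u v w]) auto
    qed (use C1 in \<open>auto intro: C1_curve_speed_integrable\<close>)
  qed
qed

lemma C1_curve_on_affine:
  assumes \<gamma>: "C1_curve_on A (m * a + k) (m * b + k) \<gamma>" and m: "0 < m"
    and \<eta>: "\<And>t. t \<in> {a..b} \<Longrightarrow> \<eta> t = \<gamma> (m * t + k)"
  shows "C1_curve_on A a b \<eta>"
proof -
  let ?h = "\<lambda>t. m * t + k"
  have img: "?h ` {a..b} = {m * a + k..m * b + k}"
    using m by (simp add: image_affinity_atLeastAtMost)
  have "continuous_on {m * a + k..m * b + k} \<gamma>"
    using \<gamma> by (simp add: C1_curve_on_def)
  then have "continuous_on {a..b} (\<lambda>t. \<gamma> (?h t))"
    by (rule continuous_on_compose2) (use img in \<open>auto intro!: continuous_intros\<close>)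
  then have "continuous_on {a..b} \<eta>"
    by (rule continuous_on_eq) (simp add: \<eta>)
  moreover have "\<exists>D. continuous_on {t \<in> {a..b}. \<eta> t \<in> fst c} D \<and>
        (\<forall>t\<in>{a..b}. \<eta> t \<in> fst c \<longrightarrow> ((snd c \<circ> \<eta>) has_vector_derivative D t) (at t within {a..b}))"
    if c: "c \<in> A" for c
  proof -
    obtain D where D: "continuous_on {t \<in> {m * a + k..m * b + k}. \<gamma> t \<in> fst c} D"
      and deriv: "\<forall>t\<in>{m * a + k..m * b + k}. \<gamma> t \<in> fst c \<longrightarrow>
        ((snd c \<circ> \<gamma>) has_vector_derivative D t) (at t within {m * a + k..m * b + k})"
      using C1_curve_on_derivE[OF \<gamma> c] .
    have "continuous_on {t \<in> {a..b}. \<eta> t \<in> fst c} (\<lambda>t. D (?h t))"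
      by (rule continuous_on_compose2[OF D]) (use \<eta> m img in \<open>auto intro!: continuous_intros\<close>)
    then have "continuous_on {t \<in> {a..b}. \<eta> t \<in> fst c} (\<lambda>t. m *\<^sub>R D (?h t))"
      by (intro continuous_intros)
    moreover have "((snd c \<circ> \<eta>) has_vector_derivative m *\<^sub>R D (?h t)) (at t within {a..b})"
      if t: "t \<in> {a..b}" "\<eta> t \<in> fst c" for t
    proof -
      have "?h t \<in> {m * a + k..m * b + k}" using t img by blast
      then have "((snd c \<circ> \<gamma>) has_vector_derivative D (?h t)) (at (?h t) within ?h ` {a..b})"
        unfolding img using t \<eta> by (intro deriv[rule_format]) auto
      moreover have "(?h has_vector_derivative m) (at t within {a..b})"
        by (auto intro!: derivative_eq_intros simp: has_real_derivative_iff_has_vector_derivative[symmetric])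
      ultimately have "((snd c \<circ> \<gamma> \<circ> ?h) has_vector_derivative m *\<^sub>R D (?h t)) (at t within {a..b})"
        by (intro vector_diff_chain_within)
      then show ?thesis
        using t \<eta> by (elim has_vector_derivative_transform[rotated 2]) auto
    qed
    ultimately show ?thesis by blast
  qed
  ultimately show ?thesis unfolding C1_curve_on_def by blast
qed

lemma piecewise_C1_curve_joinpaths:
  assumes \<gamma>: "piecewise_C1_curve A \<gamma>" and \<eta>: "piecewise_C1_curve A \<eta>" and eq: "\<gamma> 1 = \<eta> 0"
  shows "piecewise_C1_curve A (\<gamma> +++ \<eta>)"
proof -
  obtain S where S: "finite S" "0 \<in> S" "1 \<in> S" "S \<subseteq> {0..1}"
    and C1: "\<And>a b. a \<in> S \<Longrightarrow> b \<in> S \<Longrightarrow> a < b \<Longrightarrow> S \<inter> {a<..<b} = {} \<Longrightarrow> C1_curve_on A a b \<gamma>"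
    using piecewise_C1_curve_partition[OF \<gamma>] by metis
  obtain T where T: "finite T" "0 \<in> T" "1 \<in> T" "T \<subseteq> {0..1}"
    and C1': "\<And>a b. a \<in> T \<Longrightarrow> b \<in> T \<Longrightarrow> a < b \<Longrightarrow> T \<inter> {a<..<b} = {} \<Longrightarrow> C1_curve_on A a b \<eta>"
    using piecewise_C1_curve_partition[OF \<eta>] by metis
  let ?h = "\<lambda>t::real. 2 * t" and ?k = "\<lambda>t::real. 2 * t - 1"
  \<comment> \<open>The preimages of both partitions. Their common point 1/2, from 1 in
    \<open>S\<close> and from 0 in \<open>T\<close>, forces each piece into one half.\<close>
  define R where "R = {t. ?h t \<in> S} \<union> {t. ?k t \<in> T}"
  have "finite R"
    unfolding R_def using finite_vimage_double[OF S(1), of 0] finite_vimage_double[OF T(1), of "-1"] by simp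
  moreover have "{0, 1} \<subseteq> R" "R \<subseteq> {0..1}" using S T by (auto simp: R_def)
  moreover have "C1_curve_on A a b (\<gamma> +++ \<eta>)" if ab: "a \<in> R" "b \<in> R" "a < b" "R \<inter> {a<..<b} = {}" for a b
  proof -
    have half: "1 / 2 \<in> R" using S by (simp add: R_def)
    have "b \<le> 1/2 \<or> 1/2 \<le> a" using half ab by force
    then show ?thesis
    proof
      assume b: "b \<le> 1/2"
      \<comment> \<open>A point of the left half that comes from \<open>T\<close> can only be 1/2,
        which also comes from 1 in \<open>S\<close>.\<close>
      have mem: "2 * t \<in> S" if "t \<in> R" "t \<le> 1/2" for t
      proof (cases "2 * t \<in> S")
        case False
        then have "2 * t - 1 \<in> T" using that by (simp add: R_def)
        then have "2 * t = 1" using T that by force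
        then show ?thesis using S by simp
      qed
      have "S \<inter> {2 * a<..<2 * b} = {}"
      proof (rule ccontr)
        assume "\<not> ?thesis"
        then obtain s where "s \<in> S" "2 * a < s" "s < 2 * b" by auto
        then have "s / 2 \<in> R \<inter> {a<..<b}" by (auto simp: R_def)
        then show False using ab by blast
      qed
      then have "C1_curve_on A (2 * a + 0) (2 * b + 0) \<gamma>"
        using mem[of a] mem[of b] ab b by (simp add: C1)
      then show ?thesis
        by (rule C1_curve_on_affine) (use b in \<open>auto simp: joinpaths_def\<close>)
    next
      assume a: "1/2 \<le> a"
      have mem: "2 * t - 1 \<in> T" if "t \<in> R" "1/2 \<le> t" for t
      proof (cases "2 * t - 1 \<in> T")
        case False
        then have "2 * t \<in> S" using that by (simp add: R_def)
        then have "2 * t = 1" using S that by force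
        then show ?thesis using T by simp
      qed
      have "T \<inter> {2 * a - 1<..<2 * b - 1} = {}"
      proof (rule ccontr)
        assume "\<not> ?thesis"
        then obtain s where "s \<in> T" "2 * a - 1 < s" "s < 2 * b - 1" by auto
        then have "(s + 1) / 2 \<in> R \<inter> {a<..<b}" by (simp add: R_def add_divide_distrib)
        then show False using ab by blast
      qed
      then have "C1_curve_on A (2 * a + - 1) (2 * b + - 1) \<eta>"
        using mem[of a] mem[of b] ab a by (simp add: C1')
      then show ?thesis
      proof (rule C1_curve_on_affine)
        fix t assume t: "t \<in> {a..b}"
        show "(\<gamma> +++ \<eta>) t = \<eta> (2 * t + - 1)"
        proof (cases "t \<le> 1/2")
          case True
          \<comment> \<open>At 1/2 \<open>joinpaths\<close> takes the value of the first curve;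
            \<open>eq\<close> turns it into the starting point of the second.\<close>
          then have "t = 1/2" using t a by simp
          show ?thesis unfolding \<open>t = 1/2\<close> using eq by (simp add: joinpaths_def)
        qed (simp add: joinpaths_def)
      qed simp
    qed
  qed
  ultimately show ?thesis
    unfolding piecewise_C1_curve_def by (intro exI[of _ R] conjI ballI impI) auto
qed

text \<open>On each half the speed is doubled while the parameter interval is halved.\<close>

lemma curve_length_joinpaths:
  assumes \<gamma>: "piecewise_C1_curve A \<gamma>" and \<eta>: "piecewise_C1_curve A \<eta>"
  shows "curve_length A g (\<gamma> +++ \<eta>) = curve_length A g \<gamma> + curve_length A g \<eta>"
proof -
  obtain S where S: "finite S" "\<forall>t\<in>{0..1} - S. has_speed \<gamma> t (speed A g \<gamma> t)"
      and "continuous_on {0..1} \<gamma>" and \<gamma>_int: "speed A g \<gamma> integrable_on {0..1}"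
    using piecewise_C1_curveE[OF \<gamma>] .
  obtain T where T: "finite T" "\<forall>t\<in>{0..1} - T. has_speed \<eta> t (speed A g \<eta> t)"
      and "continuous_on {0..1} \<eta>" and \<eta>_int: "speed A g \<eta> integrable_on {0..1}"
    using piecewise_C1_curveE[OF \<eta>] .
  have "(speed A g \<gamma> has_integral curve_length A g \<gamma>) (cbox 0 1)"
    using integrable_integral[OF \<gamma>_int] by (simp add: curve_length_def)
  from has_integral_affinity'[OF this, of 2 "0"]
  have "((\<lambda>t. speed A g \<gamma> (2 * t)) has_integral curve_length A g \<gamma> / 2) {0..1/2}"
    by simp
  from has_integral_mult_right[OF this, of 2]
  have "((\<lambda>t. 2 * speed A g \<gamma> (2 * t)) has_integral curve_length A g \<gamma>) {0..1/2}"
    by simp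
  then have 1: "(speed A g (\<gamma> +++ \<eta>) has_integral curve_length A g \<gamma>) {0..1/2}"
  proof (rule has_integral_spike_finite[rotated 2])
    \<comment> \<open>At the preimages of break points the first curve may lack a derivative, and no
      neighbourhood of 1/2 lies in one half.\<close>
    show "finite ({0, 1/2} \<union> {t. 2 * t + 0 \<in> S})" using finite_vimage_double[OF S(1)] by blast
    fix t assume t: "t \<in> {0..1/2} - ({0, 1/2} \<union> {t. 2 * t + 0 \<in> S})"
    then have "2 * t \<notin> S" by simp
    then have "has_speed \<gamma> (2 * t + 0) (speed A g \<gamma> (2 * t + 0))" using t S(2) by auto
    moreover have "\<forall>\<^sub>F u in nhds t. (\<gamma> +++ \<eta>) u = \<gamma> (2 * u + 0)"
      using eventually_nhds_in_open[of "{..<1/2}" t] t by (auto simp: joinpaths_def elim!: eventually_mono)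
    ultimately have "has_speed (\<gamma> +++ \<eta>) t (2 * speed A g \<gamma> (2 * t + 0))"
      by (rule has_speed_affine) simp
    then show "speed A g (\<gamma> +++ \<eta>) t = 2 * speed A g \<gamma> (2 * t)"
      by (simp add: speed_eq)
  qed
  have "(speed A g \<eta> has_integral curve_length A g \<eta>) (cbox 0 1)"
    using integrable_integral[OF \<eta>_int] by (simp add: curve_length_def)
  from has_integral_affinity'[OF this, of 2 "- 1"]
  have "((\<lambda>t. speed A g \<eta> (2 * t - 1)) has_integral curve_length A g \<eta> / 2) {1/2..1}"
    by simp
  from has_integral_mult_right[OF this, of 2]
  have "((\<lambda>t. 2 * speed A g \<eta> (2 * t - 1)) has_integral curve_length A g \<eta>) {1/2..1}"
    by simp
  then have 2: "(speed A g (\<gamma> +++ \<eta>) has_integral curve_length A g \<eta>) {1/2..1}"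
  proof (rule has_integral_spike_finite[rotated 2])
    show "finite ({1/2, 1} \<union> {t. 2 * t + - 1 \<in> T})" using finite_vimage_double[OF T(1)] by blast
    fix t assume t: "t \<in> {1/2..1} - ({1/2, 1} \<union> {t. 2 * t + - 1 \<in> T})"
    then have "2 * t - 1 \<notin> T" by simp
    then have "has_speed \<eta> (2 * t + - 1) (speed A g \<eta> (2 * t + - 1))" using t T(2) by auto
    moreover have "\<forall>\<^sub>F u in nhds t. (\<gamma> +++ \<eta>) u = \<eta> (2 * u + - 1)"
      using eventually_nhds_in_open[of "{1/2<..}" t] t by (auto simp: joinpaths_def elim!: eventually_mono)
    ultimately have "has_speed (\<gamma> +++ \<eta>) t (2 * speed A g \<eta> (2 * t + - 1))"
      by (rule has_speed_affine) simp
    then show "speed A g (\<gamma> +++ \<eta>) t = 2 * speed A g \<eta> (2 * t - 1)"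
      by (simp add: speed_eq)
  qed
  have "(speed A g (\<gamma> +++ \<eta>) has_integral curve_length A g \<gamma> + curve_length A g \<eta>) {0..1}"
    using has_integral_combine[OF _ _ 1 2] by simp
  then show ?thesis
    unfolding curve_length_def[of A g "\<gamma> +++ \<eta>"] by (rule integral_unique)
qed

end

section \<open>The Riemannian distance\<close>

context riemannian_atlas
begin

text \<open>Length bounds carried by a witness curve compose additively and avoid \<open>Inf\<close>
  of a set that might be empty, as long as the existence of connecting curves is not
  established.\<close>

definition connects :: "'g \<Rightarrow> 'g \<Rightarrow> real \<Rightarrow> bool" where
  "connects x y L \<longleftrightarrow> (\<exists>\<gamma>. piecewise_C1_curve A \<gamma> \<and> \<gamma> 0 = x \<and> \<gamma> 1 = y \<and> curve_length A g \<gamma> \<le> L)"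

lemma connects_trans: "connects x y K \<Longrightarrow> connects y z L \<Longrightarrow> connects x z (K + L)"
  unfolding connects_def
proof (elim exE conjE)
  fix \<gamma> \<eta> assume *: "piecewise_C1_curve A \<gamma>" "\<gamma> 0 = x" "\<gamma> 1 = y" "curve_length A g \<gamma> \<le> K"
    "piecewise_C1_curve A \<eta>" "\<eta> 0 = y" "\<eta> 1 = z" "curve_length A g \<eta> \<le> L"
  have "piecewise_C1_curve A (\<gamma> +++ \<eta>)"
    by (rule piecewise_C1_curve_joinpaths) (simp_all add: *)
  moreover have "curve_length A g (\<gamma> +++ \<eta>) \<le> K + L"
    using curve_length_joinpaths[OF *(1,5)] *(4,8) by simp
  moreover have "(\<gamma> +++ \<eta>) 0 = x" "(\<gamma> +++ \<eta>) 1 = z"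
    using * by (simp_all add: joinpaths_def)
  ultimately show "\<exists>\<gamma>. piecewise_C1_curve A \<gamma> \<and> \<gamma> 0 = x \<and> \<gamma> 1 = z \<and> curve_length A g \<gamma> \<le> K + L"
    by blast
qed

section \<open>Comparison of curve lengths with Euclidean lengths in charts\<close>

lemma connects_segment:
  assumes c: "c \<in> A" and seg: "closed_segment a b \<subseteq> chart_image c"
    and bound: "\<And>y. y \<in> closed_segment a b \<Longrightarrow> sqrt (g c (coord_inv c y) (b - a) (b - a)) \<le> L"
  shows "connects (coord_inv c a) (coord_inv c b) L"
proof -
  \<comment> \<open>The curve is a straight line in the coordinates of \<open>c\<close>, with
    constant velocity b - a; transition maps make it C1 in the other charts.\<close>
  define l where "l = (\<lambda>t::real. a + t *\<^sub>R (b - a))"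
  define \<gamma> where "\<gamma> = (\<lambda>t. coord_inv c (l t))"
  have l_seg: "l t \<in> closed_segment a b" if "t \<in> {0..1}" for t
    using that by (auto simp: l_def in_segment algebra_simps intro!: exI[of _ t])
  then have l_in: "l t \<in> chart_image c" if "t \<in> {0..1}" for t
    using that seg by blast
  have l_cont: "continuous_on X l" for X
    unfolding l_def by (intro continuous_intros)
  have l_deriv: "(l has_vector_derivative (b - a)) (at t within X)" for t X
    unfolding l_def by (auto intro!: derivative_eq_intros)
  have \<gamma>_cont: "continuous_on {0..1} \<gamma>"
    unfolding \<gamma>_def
    by (rule continuous_on_compose2[OF continuous_on_coord_inv[OF c] l_cont]) (use l_in in blast)
  have "C1_curve_on A 0 1 \<gamma>"
    unfolding C1_curve_on_def
  proof (intro conjI ballI \<gamma>_cont)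
    fix c' assume c': "c' \<in> A"
    let ?T = "snd c' \<circ> coord_inv c" and ?W = "chart_image c \<inter> coord_inv c -` fst c'"
    let ?D = "\<lambda>t. frechet_derivative ?T (at (l t)) (b - a)"
    have "continuous_on {t \<in> {0..1}. \<gamma> t \<in> fst c'} ?D"
      by (rule continuous_on_compose2[OF transition_smooth(3)[OF c c'] l_cont]) (use l_in in \<open>auto simp: \<gamma>_def\<close>)
    moreover have "((snd c' \<circ> \<gamma>) has_vector_derivative ?D t) (at t within {0..1})"
      if t: "t \<in> {0..1}" "\<gamma> t \<in> fst c'" for t
    proof -
      have "l t \<in> ?W" using t l_in by (simp add: \<gamma>_def)
      from vector_derivative_diff_chain_within[OF l_deriv has_derivative_at_withinI[OF transition_smooth(2)[OF c c' this]]]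
      show ?thesis by (simp add: \<gamma>_def comp_def)
    qed
    ultimately show "\<exists>D. continuous_on {t \<in> {0..1}. \<gamma> t \<in> fst c'} D \<and>
        (\<forall>t\<in>{0..1}. \<gamma> t \<in> fst c' \<longrightarrow> ((snd c' \<circ> \<gamma>) has_vector_derivative D t) (at t within {0..1}))"
      by (intro exI[of _ ?D]) blast
  qed
  then have pw: "piecewise_C1_curve A \<gamma>"
    unfolding piecewise_C1_curve_def by (intro exI[of _ "{0, 1}"]) auto
  have le: "speed A g \<gamma> t \<le> L" if t: "t \<in> {0..1}" for t
  proof -
    have "isCont l t"
      using l_cont[of UNIV] by (simp add: continuous_on_eq_continuous_at)
    moreover have "isCont (coord_inv c) (l t)"
      using continuous_on_coord_inv[OF c] open_chart_image[OF c] l_in[OF t] by (simp add: continuous_on_eq_continuous_at)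
    ultimately have cont: "isCont \<gamma> t"
      unfolding \<gamma>_def by (rule isCont_o2)
    \<comment> \<open>The line is defined for all real parameters and stays in the chart slightly
      beyond [0, 1], so two-sided derivatives exist also at 0 and 1.\<close>
    have "open (l -` chart_image c)"
      using open_chart_image[OF c] l_cont[of UNIV] by (simp add: continuous_on_open_vimage)
    moreover have "t \<in> l -` chart_image c"
      using l_in[OF t] by simp
    ultimately have "((snd c \<circ> \<gamma>) has_vector_derivative (b - a)) (at t)"
      by (rule has_vector_derivative_transform_within_open[OF l_deriv]) (simp add: \<gamma>_def chart_coord_inv[OF c])
    from has_speedI[OF c cont _ this]
    have "speed A g \<gamma> t = sqrt (g c (\<gamma> t) (b - a) (b - a))"
      using coord_inv_in[OF c l_in[OF t]] by (intro speed_eq) (simp add: \<gamma>_def)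
    also have "\<dots> \<le> L"
      unfolding \<gamma>_def by (rule bound[OF l_seg[OF t]])
    finally show ?thesis .
  qed
  have int: "speed A g \<gamma> integrable_on {0..1}"
    using pw by (rule piecewise_C1_curveE)
  have "curve_length A g \<gamma> \<le> integral {0..1::real} (\<lambda>_. L)"
    unfolding curve_length_def by (rule Henstock_Kurzweil_Integration.integral_le[OF int integrable_const_ivl le])
  moreover have "\<gamma> 0 = coord_inv c a" "\<gamma> 1 = coord_inv c b"
    by (simp_all add: \<gamma>_def l_def)
  ultimately show ?thesis
    unfolding connects_def using pw by (intro exI[of _ \<gamma>]) simp
qed

lemma chart_cball:
  assumes c: "c \<in> A" "x \<in> fst c" and U: "open U" "x \<in> U"
  obtains R where "0 < R" "cball (snd c x) R \<subseteq> chart_image c" "coord_inv c ` cball (snd c x) R \<subseteq> U"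
proof -
  have "open (snd c ` (U \<inter> fst c))"
    using open_chart[OF c(1)] U by (intro open_chart_image_of[OF c(1)]) auto
  moreover have "snd c x \<in> snd c ` (U \<inter> fst c)"
    using c U by blast
  ultimately obtain R where "0 < R" and R: "cball (snd c x) R \<subseteq> snd c ` (U \<inter> fst c)"
    using open_contains_cball by blast
  moreover have "snd c ` (U \<inter> fst c) \<subseteq> chart_image c" "coord_inv c ` snd c ` (U \<inter> fst c) \<subseteq> U"
    using chart_in[OF c(1)] coord_inv_chart[OF c(1)] by auto
  ultimately show thesis by (intro that[of R]) blast+
qed

text \<open>The upper metric bound makes coordinate segments from and to \<open>x\<close>
  short.\<close>

lemma eventually_connects:
  assumes "0 < e"
  shows "\<forall>\<^sub>F y in nhds x. connects x y e \<and> connects y x e"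
proof -
  obtain c where c: "c \<in> A" "x \<in> fst c" using chart_at .
  obtain R where R: "0 < R" "cball (snd c x) R \<subseteq> chart_image c"
    using chart_cball[OF c open_UNIV UNIV_I] .
  obtain l L where L: "0 < L" "\<And>a v. a \<in> cball (snd c x) R \<Longrightarrow> sqrt (g c (coord_inv c a) v v) \<le> L * norm v"
    using metric_bounds_compact[OF c(1) compact_cball _ R(2)] R(1) by (metis cball_eq_empty less_le_not_le)
  \<comment> \<open>The bound \<open>R\<close> keeps segments where \<open>L\<close> is valid, and
    the bound e / L makes their length at most \<open>e\<close>.\<close>
  define r where "r = min R (e / L)"
  have "0 < r" "r \<le> R" "L * r \<le> e"
    using R L \<open>0 < e\<close> by (auto simp: r_def min_def field_simps)
  have sub: "ball (snd c x) r \<subseteq> cball (snd c x) R"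
    using \<open>r \<le> R\<close> by auto
  have conn: "connects (coord_inv c a) (coord_inv c b) e"
    if ab: "a \<in> ball (snd c x) r" "b \<in> ball (snd c x) r" "dist a b \<le> r" for a b
  proof (rule connects_segment[OF c(1)])
    have seg: "closed_segment a b \<subseteq> cball (snd c x) R"
      using closed_segment_subset[OF ab(1,2) convex_ball] sub by blast
    then show "closed_segment a b \<subseteq> chart_image c" using R by blast
    fix y assume "y \<in> closed_segment a b"
    then have "sqrt (g c (coord_inv c y) (b - a) (b - a)) \<le> L * norm (b - a)"
      using seg by (intro L) blast
    also have "\<dots> \<le> L * r"
      using ab L by (intro mult_left_mono) (auto simp: dist_norm norm_minus_commute)
    also have "\<dots> \<le> e" by fact
    finally show "sqrt (g c (coord_inv c y) (b - a) (b - a)) \<le> e" .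
  qed
  have x: "snd c x \<in> ball (snd c x) r" "coord_inv c (snd c x) = x"
    using \<open>0 < r\<close> coord_inv_chart[OF c(1,2)] by auto
  have "open (coord_inv c ` ball (snd c x) r)"
    using sub R by (intro open_coord_inv_image[OF c(1)]) auto
  moreover have "x \<in> coord_inv c ` ball (snd c x) r"
    using x by (metis image_eqI)
  ultimately have "\<forall>\<^sub>F y in nhds x. y \<in> coord_inv c ` ball (snd c x) r"
    by (rule eventually_nhds_in_open)
  then show ?thesis
  proof eventually_elim
    case (elim y)
    then obtain b where b: "b \<in> ball (snd c x) r" "y = coord_inv c b" by blast
    then show ?case
      using conn[OF x(1) b(1)] conn[OF b(1) x(1)] x(2) by (simp add: dist_commute)
  qed
qed

text \<open>A curve that leaves a chart ball of radius \<open>R\<close> has already covered the coordinate distance \<open>R\<close>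
  before its first exit, hence has length at least \<open>l * R\<close>.\<close>
lemma short_curves_stay:
  assumes U: "open U" "x \<in> U"
  obtains \<delta> where "0 < \<delta>" "\<And>y L. connects x y L \<Longrightarrow> L < \<delta> \<Longrightarrow> y \<in> U"
proof -
  obtain c where c: "c \<in> A" "x \<in> fst c" using chart_at .
  obtain R where R: "0 < R" "cball (snd c x) R \<subseteq> chart_image c" "coord_inv c ` cball (snd c x) R \<subseteq> U"
    using chart_cball[OF c U] .
  obtain l where l: "0 < l" "\<And>a v. a \<in> cball (snd c x) R \<Longrightarrow> l * norm v \<le> sqrt (g c (coord_inv c a) v v)"
    using metric_bounds_compact[OF c(1) compact_cball _ R(2)] R(1) by (metis cball_eq_empty less_le_not_le)
  let ?W = "coord_inv c ` ball (snd c x) R" and ?C = "coord_inv c ` cball (snd c x) R"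
  have "open ?W"
    using R by (intro open_coord_inv_image[OF c(1)]) auto
  have "compact ?C"
    using R by (intro compact_continuous_image continuous_on_subset[OF continuous_on_coord_inv[OF c(1)]]) auto
  then have "closed ?C" by (rule compact_imp_closed)
  have xW: "x \<in> ?W"
    using R coord_inv_chart[OF c] by (intro image_eqI[of _ _ "snd c x"]) auto
  have "y \<in> U" if conn: "connects x y L" and L: "L < l * R" for y L
  proof (rule ccontr)
    assume "y \<notin> U"
    then have "y \<notin> ?W" using R(3) by force
    obtain \<gamma> where \<gamma>: "piecewise_C1_curve A \<gamma>" "\<gamma> 0 = x" "\<gamma> 1 = y" "curve_length A g \<gamma> \<le> L"
      using conn unfolding connects_def by blast
    obtain S where S: "finite S" and speed: "\<forall>t\<in>{0..1} - S. has_speed \<gamma> t (speed A g \<gamma> t)"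
      and cont: "continuous_on {0..1} \<gamma>" and int: "speed A g \<gamma> integrable_on {0..1}"
      using piecewise_C1_curveE[OF \<gamma>(1)] .
    \<comment> \<open>The times at which the curve is outside the open coordinate ball. This set is
      compact and contains 1, so there is a first such time \<open>T\<close>.\<close>
    define E where "E = {0..1} \<inter> \<gamma> -` (- ?W)"
    have "closed E"
      unfolding E_def using \<open>open ?W\<close> by (intro continuous_closed_preimage[OF cont]) auto
    moreover have "E \<subseteq> {0..1}" by (simp add: E_def)
    ultimately have "compact E"
      using compact_Int_closed[of "{0..1}" E] by (simp add: Int_absorb1)
    moreover have "1 \<in> E"
      unfolding E_def using \<gamma>(3) \<open>y \<notin> ?W\<close> by simp
    then have "E \<noteq> {}" by blast
    ultimately obtain T where T: "T \<in> E" and first: "\<forall>t\<in>E. T \<le> t"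
      using compact_attains_inf[of E] by metis
    have T_W: "\<gamma> T \<notin> ?W" and "0 \<le> T" "T \<le> 1"
      using T by (simp_all add: E_def)
    have "T \<noteq> 0" using T_W xW \<gamma>(2) by metis
    then have T01: "0 < T" "T \<le> 1" using \<open>0 \<le> T\<close> \<open>T \<le> 1\<close> by simp_all
    \<comment> \<open>Before \<open>T\<close> the curve is in the open ball; since \<open>?C\<close>
      is closed, the curve is still in \<open>?C\<close> at time \<open>T\<close>, where the metric
      bound holds.\<close>
    have before: "\<gamma> ` {0..<T} \<subseteq> ?C"
    proof
      fix z assume "z \<in> \<gamma> ` {0..<T}"
      then obtain t where t: "t \<in> {0..<T}" "z = \<gamma> t" by blast
      then have "t \<notin> E" using first by force
      then have "\<gamma> t \<in> ?W" using t(1) T01 by (simp add: E_def)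
      then show "z \<in> ?C" unfolding t(2) using ball_subset_cball by blast
    qed
    have cl: "closure {0..<T} = {0..T}"
      using T01 by (simp add: closure_atLeastLessThan)
    have cont_T: "continuous_on {0..T} \<gamma>"
      using T01 by (intro continuous_on_subset[OF cont]) auto
    have in_C: "\<gamma> ` {0..T} \<subseteq> ?C"
      using image_closure_subset[OF _ \<open>closed ?C\<close> before] cont_T unfolding cl by blast
    have C_chart: "?C \<subseteq> fst c"
      using R coord_inv_in[OF c(1)] by blast
    have cont_c: "continuous_on {0..T} (snd c \<circ> \<gamma>)"
      using continuous_on_compose2[OF continuous_on_chart[OF c(1)] cont_T] in_C C_chart by (auto simp: comp_def)
    \<comment> \<open>The value 0 at break points makes the estimate of \<open>norm (v t)\<close> by
      the speed valid at every time.\<close>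
    define v where "v = (\<lambda>t. if t \<in> S then 0 else vector_derivative (snd c \<circ> \<gamma>) (at t))"
    have v: "((snd c \<circ> \<gamma>) has_vector_derivative v t) (at t)" "l * norm (v t) \<le> speed A g \<gamma> t"
      if t: "t \<in> {0..T} - S" for t
    proof -
      have "has_speed \<gamma> t (speed A g \<gamma> t)" "\<gamma> t \<in> ?C"
        using speed t T01 in_C by auto
      then obtain w where w: "((snd c \<circ> \<gamma>) has_vector_derivative w) (at t)" "speed A g \<gamma> t = sqrt (g c (\<gamma> t) w w)"
        using c(1) C_chart unfolding has_speed_def by blast
      then have "v t = w"
        using t by (simp add: v_def vector_derivative_at)
      then show "((snd c \<circ> \<gamma>) has_vector_derivative v t) (at t)" "l * norm (v t) \<le> speed A g \<gamma> t"
        using w \<open>\<gamma> t \<in> ?C\<close> l(2) by auto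
    qed
    have "(v has_integral (snd c \<circ> \<gamma>) T - (snd c \<circ> \<gamma>) 0) {0..T}"
    proof (rule fundamental_theorem_of_calculus_interior_strong[OF S _ _ cont_c])
      show "((snd c \<circ> \<gamma>) has_vector_derivative v t) (at t)" if "t \<in> {0<..<T} - S" for t
        using that by (intro v(1)) auto
    qed (use T01 in simp)
    then have v_int: "v integrable_on {0..T}" "integral {0..T} v = snd c (\<gamma> T) - snd c x"
      using \<gamma>(2) by (auto simp: has_integral_iff)
    have int_T: "speed A g \<gamma> integrable_on {0..T}"
      using T01 by (intro integrable_subinterval_real[OF int]) auto
    have "norm (integral {0..T} v) \<le> integral {0..T} (\<lambda>t. speed A g \<gamma> t / l)"
    proof (rule Henstock_Kurzweil_Integration.integral_norm_bound_integral)
      show "(\<lambda>t. speed A g \<gamma> t / l) integrable_on {0..T}"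
        using int_T l(1) integrable_on_cdivide_iff[of l] by simp
      fix t assume "t \<in> {0..T}"
      show "norm (v t) \<le> speed A g \<gamma> t / l"
      proof (cases "t \<in> S")
        case True
        then show ?thesis using l speed_nonneg by (simp add: v_def)
      next
        case False
        then show ?thesis using v(2)[of t] \<open>t \<in> {0..T}\<close> l by (simp add: field_simps)
      qed
    qed (use v_int in simp)
    also have "\<dots> = integral {0..T} (speed A g \<gamma>) / l"
      by simp
    also have "\<dots> \<le> curve_length A g \<gamma> / l"
      unfolding curve_length_def using l T01 int int_T speed_nonneg
      by (intro divide_right_mono integral_subset_le) auto
    also have "\<dots> \<le> L / l"
      using \<gamma>(4) l by (intro divide_right_mono) auto
    also have "\<dots> < R"
      using L l by (simp add: field_simps)
    finally have less: "norm (snd c (\<gamma> T) - snd c x) < R"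
      unfolding v_int .
    \<comment> \<open>The coordinate displacement up to \<open>T\<close> is less than
      \<open>R\<close>, so the curve is in the open ball at time \<open>T\<close>, contrary to the
      choice of \<open>T\<close>.\<close>
    obtain a where a: "a \<in> cball (snd c x) R" "\<gamma> T = coord_inv c a"
      using in_C T01 by (metis atLeastAtMost_iff image_iff image_subset_iff less_imp_le order_refl)
    then have "snd c (\<gamma> T) = a"
      using chart_coord_inv[OF c(1)] R by auto
    then have "a \<in> ball (snd c x) R"
      using less by (simp add: dist_norm norm_minus_commute)
    then show False using T_W a(2) by blast
  qed
  then show thesis using R l by (intro that[of "l * R"]) auto
qed

text \<open>The set of points reachable from \<open>x\<close> is open and closed. Short curves away
  from \<open>z\<close> show that it is open, short curves into \<open>z\<close> that its complement
  is.\<close>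

lemma connects_exists:
  assumes "connected (UNIV :: 'g set)"
  shows "\<exists>L. connects x y L"
proof -
  let ?R = "{y. \<exists>L. connects x y L}"
  have near: "\<forall>\<^sub>F y in nhds z. connects z y 1 \<and> connects y z 1" for z
    by (rule eventually_connects) simp
  have "open ?R"
  proof (subst open_subopen, intro ballI)
    fix z assume z: "z \<in> ?R"
    obtain T where "open T" "z \<in> T" "\<And>y. y \<in> T \<Longrightarrow> connects z y 1"
      using near[of z] unfolding eventually_nhds by blast
    then show "\<exists>T. open T \<and> z \<in> T \<and> T \<subseteq> ?R"
      using z connects_trans by (intro exI[of _ T]) blast
  qed
  moreover have "open (- ?R)"
  proof (subst open_subopen, intro ballI)
    fix z assume z: "z \<in> - ?R"
    obtain T where "open T" "z \<in> T" "\<And>y. y \<in> T \<Longrightarrow> connects y z 1"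
      using near[of z] unfolding eventually_nhds by blast
    then show "\<exists>T. open T \<and> z \<in> T \<and> T \<subseteq> - ?R"
      using z connects_trans by (intro exI[of _ T]) blast
  qed
  moreover have "x \<in> ?R"
    using eventually_nhds_x_imp_x[OF near] by blast
  ultimately have "?R = UNIV"
    using assms connected_clopen[of UNIV] by (auto simp: closed_def)
  then show ?thesis by blast
qed

text \<open>For curves whose speed is not integrable, \<open>integral\<close> takes its default
  value 0.\<close>

lemma curve_length_nonneg: "0 \<le> curve_length A g \<gamma>"
  unfolding curve_length_def
  by (cases "speed A g \<gamma> integrable_on {0..1}")
    (auto simp: not_integrable_integral intro: integral_nonneg speed_nonneg)

section \<open>The distance as an infimum of lengths\<close>

lemma riemannian_dist_le:
  assumes "connects x y L"
  shows "riemannian_dist A g x y \<le> L"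
proof -
  have "bdd_below {curve_length A g \<gamma> | \<gamma>. piecewise_C1_curve A \<gamma> \<and> \<gamma> 0 = x \<and> \<gamma> 1 = y}"
    using curve_length_nonneg by (intro bdd_belowI[of _ 0]) auto
  then show ?thesis
    using assms unfolding riemannian_dist_def connects_def by (auto intro: cInf_lower2)
qed

text \<open>The first hypothesis guarantees that the set of lengths is nonempty, so that a number
  above its infimum exceeds some length.\<close>

lemma connects_if_dist_less:
  assumes "connects x y K" "riemannian_dist A g x y < L"
  shows "connects x y L"
proof -
  have "{curve_length A g \<gamma> | \<gamma>. piecewise_C1_curve A \<gamma> \<and> \<gamma> 0 = x \<and> \<gamma> 1 = y} \<noteq> {}"
    using assms(1) unfolding connects_def by blast
  from cInf_lessD[OF this, of L] assms(2) show ?thesis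
    unfolding riemannian_dist_def connects_def by (auto intro: less_imp_le)
qed

lemma riemannian_dist_nonneg:
  assumes "connects x y K"
  shows "0 \<le> riemannian_dist A g x y"
  using assms curve_length_nonneg unfolding riemannian_dist_def connects_def
  by (intro cInf_greatest) auto

lemma riemannian_dist_tendsto:
  shows "((\<lambda>y. riemannian_dist A g x y) \<longlongrightarrow> 0) (nhds x)"
    and "((\<lambda>y. riemannian_dist A g y x) \<longlongrightarrow> 0) (nhds x)"
proof -
  have ev: "\<forall>\<^sub>F y in nhds x. dist (riemannian_dist A g x y) 0 < e \<and> dist (riemannian_dist A g y x) 0 < e"
    if "0 < e" for e
    using eventually_connects[of "e / 2" x]
  proof (rule eventually_mono)
    fix y assume "connects x y (e / 2) \<and> connects y x (e / 2)"
    then show "dist (riemannian_dist A g x y) 0 < e \<and> dist (riemannian_dist A g y x) 0 < e"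
      using riemannian_dist_le[of x y "e / 2"] riemannian_dist_le[of y x "e / 2"]
        riemannian_dist_nonneg[of x y] riemannian_dist_nonneg[of y x] \<open>0 < e\<close> by auto
  qed (use that in simp)
  show "((\<lambda>y. riemannian_dist A g x y) \<longlongrightarrow> 0) (nhds x)" "((\<lambda>y. riemannian_dist A g y x) \<longlongrightarrow> 0) (nhds x)"
    unfolding tendsto_iff by (intro allI impI, erule eventually_mono[OF ev], blast)+
qed

text \<open>Curves whose lengths exceed the two distances by at most e / 2 each are
  concatenated.\<close>

lemma riemannian_dist_triangle:
  assumes "connected (UNIV :: 'g set)"
  shows "riemannian_dist A g x z \<le> riemannian_dist A g x y + riemannian_dist A g y z"
proof (rule field_le_epsilon)
  fix e :: real assume "0 < e"
  have conn: "connects x y (riemannian_dist A g x y + e / 2)" for x y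
  proof -
    obtain K where "connects x y K" using connects_exists[OF assms] by blast
    then show ?thesis by (rule connects_if_dist_less) (use \<open>0 < e\<close> in simp)
  qed
  from riemannian_dist_le[OF connects_trans[OF conn[of x y] conn[of y z]]]
  show "riemannian_dist A g x z \<le> riemannian_dist A g x y + riemannian_dist A g y z + e"
    by simp
qed

lemma riemannian_ball_subset_open:
  assumes "connected (UNIV :: 'g set)" "open U" "x \<in> U"
  shows "\<exists>\<delta>>0. dist_ball (riemannian_dist A g) x \<delta> \<subseteq> U"
proof -
  obtain \<delta> where \<delta>: "0 < \<delta>" "\<And>y L. connects x y L \<Longrightarrow> L < \<delta> \<Longrightarrow> y \<in> U"
    using short_curves_stay[OF assms(2,3)] by blast
  have "y \<in> U" if "riemannian_dist A g x y < \<delta>" for y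
  proof -
    obtain L where L: "riemannian_dist A g x y < L" "L < \<delta>"
      using dense[OF \<open>riemannian_dist A g x y < \<delta>\<close>] by (elim exE conjE)
    obtain K where "connects x y K"
      using connects_exists[OF assms(1)] by (rule exE)
    then have "connects x y L" using L(1) by (rule connects_if_dist_less)
    then show ?thesis using L(2) by (rule \<delta>(2))
  qed
  then show ?thesis using \<delta>(1) by (auto simp: dist_ball_def)
qed

section \<open>Positivity of the Riemannian measure on open sets\<close>

lemma det_gram_pos:
  assumes "c \<in> A" "x \<in> fst c"
  shows "0 < det (gram_matrix g c x)"
proof (rule det_pos_if_positive_definite)
  fix v :: "real ^ 'n" assume "v \<noteq> 0"
  have "v \<bullet> (gram_matrix g c x *v v) = (\<Sum>i\<in>UNIV. \<Sum>j\<in>UNIV. v $ i * v $ j * g c x (axis i 1) (axis j 1))"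
    by (simp add: inner_vec_def matrix_vector_mult_def gram_matrix_def sum_distrib_left mult_ac)
  also have "\<dots> = g c x v v"
    by (simp only: bilinear_vec_expand[OF bilinear_metric[OF assms], of v v] sum.cartesian_product UNIV_Times_UNIV)
  finally show "0 < v \<bullet> (gram_matrix g c x *v v)"
    using metric_pos[OF assms \<open>v \<noteq> 0\<close>] by simp
qed

text \<open>On a closed coordinate ball inside \<open>U\<close> the continuous density attains a
  positive minimum, and the ball has positive Lebesgue measure.\<close>

lemma riemannian_measure_open:
  assumes \<rho>: "is_riemannian_measure A g \<rho>" and U: "open U" "U \<noteq> {}"
  shows "emeasure \<rho> U \<noteq> 0"
proof -
  obtain x where x: "x \<in> U" using U by blast
  obtain c where c: "c \<in> A" "x \<in> fst c" using chart_at .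
  let ?E = "U \<inter> fst c" and ?s = "\<lambda>a. sqrt (det (gram_matrix g c (coord_inv c a)))"
  obtain R where R: "0 < R" "cball (snd c x) R \<subseteq> chart_image c" "coord_inv c ` cball (snd c x) R \<subseteq> U"
    using chart_cball[OF c U(1) x] .
  have sub: "cball (snd c x) R \<subseteq> snd c ` ?E"
  proof
    fix a assume "a \<in> cball (snd c x) R"
    then show "a \<in> snd c ` ?E"
      using R chart_coord_inv[OF c(1)] coord_inv_in[OF c(1)] by (intro image_eqI[of _ _ "coord_inv c a"]) auto
  qed
  have entry: "continuous_on (cball (snd c x) R) (\<lambda>a. gram_matrix g c (coord_inv c a) $ i $ j)" for i j
    unfolding gram_matrix_def vec_lambda_beta
    by (intro continuous_on_metric_const[OF c(1)] continuous_on_subset[OF continuous_on_coord_inv[OF c(1)] R(2)])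
      (use R(2) coord_inv_in[OF c(1)] in blast)
  have "continuous_on (cball (snd c x) R) ?s"
    unfolding det_def by (intro continuous_intros entry)
  then obtain b where b: "b \<in> cball (snd c x) R" and min: "\<And>a. a \<in> cball (snd c x) R \<Longrightarrow> ?s b \<le> ?s a"
    using continuous_attains_inf[of "cball (snd c x) R" ?s] R(1) by auto
  have "0 < ?s b"
    using det_gram_pos[OF c(1)] coord_inv_in[OF c(1)] b R(2) by auto
  have "measure lborel (cball (snd c x) R) \<noteq> 0"
    using content_cball_pos[OF R(1), of "snd c x"] by simp
  then have "emeasure lborel (cball (snd c x) R) \<noteq> 0"
    by (auto simp: measure_def)
  then have "0 < ennreal (?s b) * emeasure lborel (cball (snd c x) R)"
    using \<open>0 < ?s b\<close> by (simp add: zero_less_iff_neq_zero)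
  also have "\<dots> = (\<integral>\<^sup>+a. ennreal (?s b) * indicator (cball (snd c x) R) a \<partial>lborel)"
    by (simp add: nn_integral_cmult_indicator)
  also have "\<dots> \<le> (\<integral>\<^sup>+a\<in>snd c ` ?E. ennreal (?s a) \<partial>lborel)"
  proof (rule nn_integral_mono)
    fix a
    show "ennreal (?s b) * indicator (cball (snd c x) R) a \<le> ennreal (?s a) * indicator (snd c ` ?E) a"
    proof (cases "a \<in> cball (snd c x) R")
      case True
      then have "a \<in> snd c ` ?E" using sub by blast
      then show ?thesis using ennreal_leI[OF min[OF True]] True by simp
    qed simp
  qed
  also have "\<dots> = emeasure \<rho> ?E"
    using \<rho> c(1) open_chart[OF c(1)] U(1) unfolding is_riemannian_measure_def by auto
  also have "\<dots> \<le> emeasure \<rho> U"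
    using \<rho> U(1) by (intro emeasure_mono) (auto simp: is_riemannian_measure_def)
  finally show ?thesis by simp
qed

end

section \<open>Application to a distance and a measure from two metrics\<close>

lemma compatible_riemannian_dist:
  fixes A :: "('g::{t2_space, second_countable_topology}, 'n::finite) chart set"
  assumes "smooth_atlas A" "connected (UNIV :: 'g set)" "riemannian_metric A gl" "riemannian_metric A gr"
    and \<rho>: "is_riemannian_measure A gr \<rho>"
  shows "compatible_distance (riemannian_dist A gl) \<rho>"
proof -
  \<comment> \<open>The distance comes from \<open>gl\<close> and the measure from
    \<open>gr\<close>; the two are linked only through the common topology.\<close>
  interpret gl: riemannian_atlas A gl by standard fact+
  interpret gr: riemannian_atlas A gr by standard fact+
  show ?thesis
  proof
    show "sets \<rho> = sets borel"
      using \<rho> by (simp add: is_riemannian_measure_def)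
    show "riemannian_dist A gl x z \<le> riemannian_dist A gl x y + riemannian_dist A gl y z" for x y z
      by (rule gl.riemannian_dist_triangle[OF assms(2)])
    show "(riemannian_dist A gl x \<longlongrightarrow> 0) (nhds x)" "((\<lambda>y. riemannian_dist A gl y x) \<longlongrightarrow> 0) (nhds x)" for x
      by (rule gl.riemannian_dist_tendsto)+
    show "\<exists>\<delta>>0. dist_ball (riemannian_dist A gl) x \<delta> \<subseteq> U" if "open U" "x \<in> U" for U x
      using assms(2) that by (rule gl.riemannian_ball_subset_open)
    show "emeasure \<rho> U \<noteq> 0" if "open U" "U \<noteq> {}" for U
      using \<rho> that by (rule gr.riemannian_measure_open)
  qed
qed

theorem mainTheorem5:
  fixes A :: "('g::{topological_group_add, t2_space, second_countable_topology}, 'n::finite) chart set"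
    and gl gr :: "('g, 'n) metric_tensor"
    and d :: "'g \<Rightarrow> 'g \<Rightarrow> real"
    and \<rho> :: "'g measure"
    and w :: "real \<Rightarrow> real"
    and p :: real
    and f :: "'g \<Rightarrow> 'k::real_normed_field"
  assumes "lie_group A"
    and "connected (UNIV :: 'g set)"
    and "\<not> compact (UNIV :: 'g set)"
    and "riemannian_metric A gl" and "left_invariant A gl"
    and "riemannian_metric A gr" and "right_invariant A gr"
    and "coincide_on_lie_algebra A gl gr"
    and "d = riemannian_dist A gl"
    and "is_riemannian_measure A gr \<rho>"
    and "radius_weight w"
    and "1 \<le> p"
    and "in_Lp \<rho> p f"
  shows "(\<forall>x. ess_bounded_near \<rho> f x \<longrightarrow> isCont (I_op d \<rho> p w f) x) \<and>
         ((AE x in \<rho>. ess_bounded_near \<rho> f x) \<longrightarrow> (AE x in \<rho>. isCont (I_op d \<rho> p w f) x))"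
proof -
  have "smooth_atlas A"
    using assms(1) by (simp add: lie_group_def)
  then interpret compatible_distance d \<rho>
    unfolding assms(9) by (rule compatible_riemannian_dist[OF _ assms(2,4,6,10)])
  have *: "isCont (I_op d \<rho> p w f) x" if "ess_bounded_near \<rho> f x" for x
    using assms(11,13,12) that by (rule isCont_I_op)
  then have "AE x in \<rho>. isCont (I_op d \<rho> p w f) x" if "AE x in \<rho>. ess_bounded_near \<rho> f x"
    using that by (rule eventually_mono[rotated])
  with * show ?thesis by blast
qed

end
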